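(* Let $\mathbf r(t)$ be a non-planar rational parametric space curve defined on an interval $I$ and let $t_0\in I$ be a parameter that is not the right endpoint of $I$. Then there exists $t_1>t_0$, $t_1\in I$, such that the segment $\mathbf r(t)$, $t\in[t_0,t_1]$, is a quasi-cubic Bézier segment.
   Context: Setting: $\mathbf r(t)=(x(t),y(t),z(t))$ with $x,y,z$ rational functions with real coefficients whose denominators do not vanish on the parameter interval, properly parametrized, and not contained in a plane (curvature $\kappa$ and torsion $\tau$ not identically zero). Here $\kappa=\|\mathbf r'\times\mathbf r''\|/\|\mathbf r'\|^3$ and $\tau$ vanishes exactly where $\det(\mathbf r',\mathbf r'',\mathbf r''')=0$. Unit tangent $\boldsymbol\alpha=\mathbf r'/\|\mathbf r'\|$, unit binormal $\boldsymbol\gamma=\mathbf r'\times\mathbf r''/\|\mathbf r'\times\mathbf r''\|$; at any parameter $s$ one uses the one-sided limits $\boldsymbol\alpha^{\pm}(s)=\lim_{t\to s^\pm}\boldsymbol\alpha(t)$, $\boldsymbol\gamma^{\pm}(s)=\lim_{t\to s^\pm}\boldsymbol\gamma(t)$ (which exist for rational curves); tangent lines $T^{\pm}(s)=\{\mathbf r(s)+\lambda\boldsymbol\alpha^{\pm}(s)\}$, osculating planes $O^{\pm}(s)=\{X:(X-\mathbf r(s))\cdot\boldsymbol\gamma^{\pm}(s)=0\}$ (at ordinary points the $\pm$ versions coincide and are written $O(s)$, $T(s)$). A point is singular if it corresponds to more than one parameter counted with multiplicity. Associated tetrahedron of the segment $[t_0,t_1]$: $\mathbf r_0=\mathbf r(t_0)$,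 $\mathbf r_3=\mathbf r(t_1)$, $L=O^+(t_0)\cap O^-(t_1)$, $\mathbf r_1=T^+(t_0)\cap L$, $\mathbf r_2=T^-(t_1)\cap L$; the tetrahedron $\mathbf r_0\mathbf r_1\mathbf r_2\mathbf r_3$ (requires these intersections to exist and $\mathbf r_1\neq\mathbf r_2$). For $t_0\le a<b\le t_1$ the associated tetrahedron of $[a,b]$ is defined the same way. Parallel point: for a segment lying on one side of a plane $Q$ with both endpoints on $Q$, a point $\mathbf r(t)$, $t$ interior, with $\mathbf r'(t)$ parallel to $Q$. Quasi-cubic Bézier segment: a segment $\mathbf r(t)$, $t\in[t_0,t_1]$, whose associated tetrahedron $\mathbf r_0\mathbf r_1\mathbf r_2\mathbf r_3$ is non-degenerate and which has the following eight properties: (Q1) the one-sided tangent directions at $t_0$ and $t_1$ are parallel to $\mathbf r_0\mathbf r_1$ and $\mathbf r_2\mathbf r_3$; (Q2) the planes $\mathbf r_0\mathbf r_1\mathbf r_2$ and $\mathbf r_1\mathbf r_2\mathbf r_3$ are $O^+(t_0)$ and $O^-(t_1)$; (Q3) $\mathbf r([t_0,t_1])$ lies in the tetrahedron; (Q4) the segment has no singular points and $\kappa(t)\ne0$, $\tau(t)\ne0$ for $t\in(t_0,t_1)$; (Q5) for all $t_0\le a<b\le t_1$ the associated tetrahedron of $[a,b]$ lies in $\mathbf r_0\mathbf r_1\mathbf r_2\mathbf r_3$; (Q6) for $t^\star\in(t_0,t_1)$, $O(t^\star)$ meets the lines $\mathbf r_0\mathbf r_1,\mathbf r_1\mathbf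 r_2,\mathbf r_2\mathbf r_3$ at points $\mathbf r_{01},\mathbf r_{12},\mathbf r_{23}$ and $\|\mathbf r_0\mathbf r_{01}\|,\|\mathbf r_1\mathbf r_{12}\|,\|\mathbf r_2\mathbf r_{23}\|$ are strictly monotone in $t^\star$; (Q7) with $\mathbf r_{03}$ the intersection of the plane $\mathbf r_1\mathbf r_2\mathbf r(t^\star)$ with line $\mathbf r_0\mathbf r_3$ and $\mathbf r_{12}'$ the intersection of the plane $\mathbf r_0\mathbf r_3\mathbf r(t^\star)$ with line $\mathbf r_1\mathbf r_2$, $\|\mathbf r_0\mathbf r_{03}\|$ and $\|\mathbf r_1\mathbf r_{12}'\|$ are strictly monotone in $t^\star\in(t_0,t_1)$; (Q8) there is exactly one parallel point associated to the plane $\mathbf r_0\mathbf r_2\mathbf r_3$ and exactly one associated to the plane $\mathbf r_0\mathbf r_1\mathbf r_3$, and they are the points of the segment at maximal distance from these planes. *)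

theory Defs
  imports "HOL-Analysis.Analysis" "HOL-Computational_Algebra.Polynomial"
begin

definition rat_curve :: "real poly ^ 3 \<Rightarrow> real poly ^ 3 \<Rightarrow> real \<Rightarrow> real ^ 3" where
  "rat_curve p q t = (\<chi> i. poly (p $ i) t / poly (q $ i) t)"

definition rat_curve_c :: "real poly ^ 3 \<Rightarrow> real poly ^ 3 \<Rightarrow> complex \<Rightarrow> 3 \<Rightarrow> complex" where
  "rat_curve_c p q z i = poly (map_poly complex_of_real (p $ i)) z / poly (map_poly complex_of_real (q $ i)) z"

definition defined_at_c :: "real poly ^ 3 \<Rightarrow> complex \<Rightarrow> bool" where
  "defined_at_c q z \<longleftrightarrow> (\<forall>i. poly (map_poly complex_of_real (q $ i)) z \<noteq> 0)"

definition proper_param :: "real poly ^ 3 \<Rightarrow> real poly ^ 3 \<Rightarrow> bool" where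
  "proper_param p q \<longleftrightarrow>
     finite {z. defined_at_c q z \<and>
                (\<exists>w. w \<noteq> z \<and> defined_at_c q w \<and> rat_curve_c p q w = rat_curve_c p q z)}"

definition non_planar :: "(real \<Rightarrow> real ^ 3) \<Rightarrow> real set \<Rightarrow> bool" where
  "non_planar r I \<longleftrightarrow> \<not> (\<exists>n c. n \<noteq> 0 \<and> (\<forall>t\<in>I. n \<bullet> r t = c))"

definition d1 :: "(real \<Rightarrow> real ^ 3) \<Rightarrow> real \<Rightarrow> real ^ 3" where
  "d1 r t = vector_derivative r (at t)"

definition d2 :: "(real \<Rightarrow> real ^ 3) \<Rightarrow> real \<Rightarrow> real ^ 3" where
  "d2 r t = vector_derivative (d1 r) (at t)"

definition d3 :: "(real \<Rightarrow> real ^ 3) \<Rightarrow> real \<Rightarrow> real ^ 3" where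
  "d3 r t = vector_derivative (d2 r) (at t)"

definition curvature :: "(real \<Rightarrow> real ^ 3) \<Rightarrow> real \<Rightarrow> real" where
  "curvature r t = norm (cross3 (d1 r t) (d2 r t)) / norm (d1 r t) ^ 3"

definition torsion :: "(real \<Rightarrow> real ^ 3) \<Rightarrow> real \<Rightarrow> real" where
  "torsion r t = (cross3 (d1 r t) (d2 r t) \<bullet> d3 r t) / norm (cross3 (d1 r t) (d2 r t)) ^ 2"

definition unit_tangent :: "(real \<Rightarrow> real ^ 3) \<Rightarrow> real \<Rightarrow> real ^ 3" where
  "unit_tangent r t = (1 / norm (d1 r t)) *\<^sub>R d1 r t"

definition unit_binormal :: "(real \<Rightarrow> real ^ 3) \<Rightarrow> real \<Rightarrow> real ^ 3" where
  "unit_binormal r t = (1 / norm (cross3 (d1 r t) (d2 r t))) *\<^sub>R cross3 (d1 r t) (d2 r t)"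

definition tangent_plus :: "(real \<Rightarrow> real ^ 3) \<Rightarrow> real \<Rightarrow> real ^ 3" where
  "tangent_plus r s = Lim (at_right s) (unit_tangent r)"

definition tangent_minus :: "(real \<Rightarrow> real ^ 3) \<Rightarrow> real \<Rightarrow> real ^ 3" where
  "tangent_minus r s = Lim (at_left s) (unit_tangent r)"

definition binormal_plus :: "(real \<Rightarrow> real ^ 3) \<Rightarrow> real \<Rightarrow> real ^ 3" where
  "binormal_plus r s = Lim (at_right s) (unit_binormal r)"

definition binormal_minus :: "(real \<Rightarrow> real ^ 3) \<Rightarrow> real \<Rightarrow> real ^ 3" where
  "binormal_minus r s = Lim (at_left s) (unit_binormal r)"

definition tline_plus :: "(real \<Rightarrow> real ^ 3) \<Rightarrow> real \<Rightarrow> (real ^ 3) set" where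
  "tline_plus r s = {r s + c *\<^sub>R tangent_plus r s | c. True}"

definition tline_minus :: "(real \<Rightarrow> real ^ 3) \<Rightarrow> real \<Rightarrow> (real ^ 3) set" where
  "tline_minus r s = {r s + c *\<^sub>R tangent_minus r s | c. True}"

definition osc_plus :: "(real \<Rightarrow> real ^ 3) \<Rightarrow> real \<Rightarrow> (real ^ 3) set" where
  "osc_plus r s = {X. (X - r s) \<bullet> binormal_plus r s = 0}"

definition osc_minus :: "(real \<Rightarrow> real ^ 3) \<Rightarrow> real \<Rightarrow> (real ^ 3) set" where
  "osc_minus r s = {X. (X - r s) \<bullet> binormal_minus r s = 0}"

definition osc :: "(real \<Rightarrow> real ^ 3) \<Rightarrow> real \<Rightarrow> (real ^ 3) set" where
  "osc r s = {X. (X - r s) \<bullet> unit_binormal r s = 0}"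

text \<open>Singular point: r(t) corresponds to more than one parameter of I counted with
 multiplicity (another parameter, or t itself with multiplicity > 1, i.e. r'(t) = 0).\<close>
definition singular_param :: "(real \<Rightarrow> real ^ 3) \<Rightarrow> real set \<Rightarrow> real \<Rightarrow> bool" where
  "singular_param r I t \<longleftrightarrow> (\<exists>s\<in>I. s \<noteq> t \<and> r s = r t) \<or> d1 r t = 0"

definition assoc_tet :: "(real \<Rightarrow> real ^ 3) \<Rightarrow> real \<Rightarrow> real \<Rightarrow>
    real ^ 3 \<Rightarrow> real ^ 3 \<Rightarrow> real ^ 3 \<Rightarrow> real ^ 3 \<Rightarrow> bool" where
  "assoc_tet r a b r0 r1 r2 r3 \<longleftrightarrow>
     r0 = r a \<and> r3 = r b \<and>
     tline_plus r a \<inter> (osc_plus r a \<inter> osc_minus r b) = {r1} \<and>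
     tline_minus r b \<inter> (osc_plus r a \<inter> osc_minus r b) = {r2} \<and>
     r1 \<noteq> r2"

definition parallel_vec :: "real ^ 3 \<Rightarrow> real ^ 3 \<Rightarrow> bool" where
  "parallel_vec u v \<longleftrightarrow> u \<noteq> 0 \<and> v \<noteq> 0 \<and> cross3 u v = 0"

definition strictly_monotone_on :: "real set \<Rightarrow> (real \<Rightarrow> real) \<Rightarrow> bool" where
  "strictly_monotone_on S f \<longleftrightarrow>
     (\<forall>x\<in>S. \<forall>y\<in>S. x < y \<longrightarrow> f x < f y) \<or> (\<forall>x\<in>S. \<forall>y\<in>S. x < y \<longrightarrow> f x > f y)"

definition parallel_to_plane :: "real ^ 3 \<Rightarrow> (real ^ 3) set \<Rightarrow> bool" where
  "parallel_to_plane v Q \<longleftrightarrow> (\<exists>a\<in>Q. a + v \<in> Q)"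

text \<open>Parallel points of the segment [t0,t1] w.r.t. a plane Q (the segment being on
 one side of Q with both endpoints on Q).\<close>
definition parallel_points :: "(real \<Rightarrow> real ^ 3) \<Rightarrow> real \<Rightarrow> real \<Rightarrow> (real ^ 3) set \<Rightarrow> (real ^ 3) set" where
  "parallel_points r t0 t1 Q = {r t | t. t0 < t \<and> t < t1 \<and> parallel_to_plane (d1 r t) Q}"

definition farthest_points :: "(real \<Rightarrow> real ^ 3) \<Rightarrow> real \<Rightarrow> real \<Rightarrow> (real ^ 3) set \<Rightarrow> (real ^ 3) set" where
  "farthest_points r t0 t1 Q =
     {x \<in> r ` {t0..t1}. \<forall>y \<in> r ` {t0..t1}. infdist y Q \<le> infdist x Q}"

definition quasi_cubic :: "(real \<Rightarrow> real ^ 3) \<Rightarrow> real set \<Rightarrow> real \<Rightarrow> real \<Rightarrow> bool" where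
  "quasi_cubic r I t0 t1 \<longleftrightarrow> t0 < t1 \<and>
   (\<exists>r0 r1 r2 r3. assoc_tet r t0 t1 r0 r1 r2 r3 \<and> \<not> coplanar {r0, r1, r2, r3} \<and>
     \<comment> \<open>Q1\<close>
     parallel_vec (tangent_plus r t0) (r1 - r0) \<and> parallel_vec (tangent_minus r t1) (r3 - r2) \<and>
     \<comment> \<open>Q2\<close>
     affine hull {r0, r1, r2} = osc_plus r t0 \<and> affine hull {r1, r2, r3} = osc_minus r t1 \<and>
     \<comment> \<open>Q3\<close>
     r ` {t0..t1} \<subseteq> convex hull {r0, r1, r2, r3} \<and>
     \<comment> \<open>Q4\<close>
     (\<forall>t. t0 < t \<and> t < t1 \<longrightarrow>
        \<not> singular_param r I t \<and> curvature r t \<noteq> 0 \<and> torsion r t \<noteq> 0) \<and>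
     \<comment> \<open>Q5\<close>
     (\<forall>a b. t0 \<le> a \<and> a < b \<and> b \<le> t1 \<longrightarrow>
        (\<exists>s0 s1 s2 s3. assoc_tet r a b s0 s1 s2 s3 \<and>
           convex hull {s0, s1, s2, s3} \<subseteq> convex hull {r0, r1, r2, r3})) \<and>
     \<comment> \<open>Q6\<close>
     (\<exists>p01 p12 p23.
        (\<forall>t. t0 < t \<and> t < t1 \<longrightarrow>
           osc r t \<inter> affine hull {r0, r1} = {p01 t} \<and>
           osc r t \<inter> affine hull {r1, r2} = {p12 t} \<and>
           osc r t \<inter> affine hull {r2, r3} = {p23 t}) \<and>
        strictly_monotone_on {t0<..<t1} (\<lambda>t. dist r0 (p01 t)) \<and>
        strictly_monotone_on {t0<..<t1} (\<lambda>t. dist r1 (p12 t)) \<and>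
        strictly_monotone_on {t0<..<t1} (\<lambda>t. dist r2 (p23 t))) \<and>
     \<comment> \<open>Q7\<close>
     (\<exists>p03 q12.
        (\<forall>t. t0 < t \<and> t < t1 \<longrightarrow>
           \<not> collinear {r1, r2, r t} \<and> \<not> collinear {r0, r3, r t} \<and>
           affine hull {r1, r2, r t} \<inter> affine hull {r0, r3} = {p03 t} \<and>
           affine hull {r0, r3, r t} \<inter> affine hull {r1, r2} = {q12 t}) \<and>
        strictly_monotone_on {t0<..<t1} (\<lambda>t. dist r0 (p03 t)) \<and>
        strictly_monotone_on {t0<..<t1} (\<lambda>t. dist r1 (q12 t))) \<and>
     \<comment> \<open>Q8\<close>
     (\<exists>p. parallel_points r t0 t1 (affine hull {r0, r2, r3}) = {p} \<and>
          farthest_points r t0 t1 (affine hull {r0, r2, r3}) = {p}) \<and>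
     (\<exists>p. parallel_points r t0 t1 (affine hull {r0, r1, r3}) = {p} \<and>
          farthest_points r t0 t1 (affine hull {r0, r1, r3}) = {p}))"

end

theory Submission
  imports Defs
begin

text \<open>
  Let \<open>e1, e2, e3\<close> be the first nonzero Taylor coefficient at \<open>t0\<close> of the increment of the curve,
  the first coefficient off its line, and the first one off their plane. In this frame the
  coordinates \<open>x, y, z\<close> vanish to increasing orders with leading coefficient 1, so \<open>u = y'/x'\<close>,
  \<open>v = z'/x'\<close> and \<open>w = v'/u'\<close> are regular at \<open>t0\<close>, and \<open>x', u', w'\<close> are positive just to the
  right of \<open>t0\<close>.

  That positivity alone implies the eight properties. The matrix relating the flags at two
  parameters \<open>s < t\<close> is totally positive, and every inequality needed is a polynomial identity
  that writes a difference as a sum of products of its positive minors. The class of such curves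
  is closed under restriction to subintervals, under reversal of the parameter, which exchanges
  the ends of the segment, and under projective duality, which exchanges points and osculating
  planes; so an inequality about chords and tangents also yields its mirror image and the
  corresponding one about osculating planes. Properness only excludes double points.\<close>

section \<open>Totally positive increments\<close>

lemma pos_if_deriv_pos:
  fixes h :: "real \<Rightarrow> real"
  assumes "continuous_on {a..b} h" "h s = 0"
    and "\<And>t. a < t \<Longrightarrow> t < b \<Longrightarrow> (h has_real_derivative h' t) (at t)"
    and "\<And>t. s < t \<Longrightarrow> t < b \<Longrightarrow> h' t > 0"
    and "a \<le> s" "s < t" "t \<le> b"
  shows "h t > 0"
proof -
  have "h s < h t"
  proof (rule DERIV_pos_imp_increasing_open[OF \<open>s < t\<close>])
    show "\<exists>l. (h has_real_derivative l) (at \<tau>) \<and> 0 < l" if "s < \<tau>" "\<tau> < t" for \<tau>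
      using assms(3)[of \<tau>] assms(4)[of \<tau>] assms(5,7) that by auto
  qed (use assms in \<open>auto intro: continuous_on_subset\<close>)
  with assms(2) show ?thesis by simp
qed

text \<open>The curve \<open>x e1 + y e2 + z e3\<close> has the moving flag \<open>T = e1 + u e2 + v e3\<close>, \<open>N = e2 + w e3\<close>,
  \<open>e3\<close>, and the conditions say that it has derivative \<open>x' T\<close>, while \<open>T' = u' N\<close> and \<open>N' = w' e3\<close>.
  Since \<open>x', u', w'\<close> may vanish at the endpoints, the curve may be singular there.\<close>

locale integral_chain =
  fixes a b :: real and x y z u v w x' u' w' :: "real \<Rightarrow> real"
  assumes a_less_b: "a < b"
    and cont: "continuous_on {a..b} x" "continuous_on {a..b} y" "continuous_on {a..b} z"
      "continuous_on {a..b} u" "continuous_on {a..b} v" "continuous_on {a..b} w"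
    and deriv: "\<And>t. a < t \<Longrightarrow> t < b \<Longrightarrow> (x has_real_derivative x' t) (at t)"
      "\<And>t. a < t \<Longrightarrow> t < b \<Longrightarrow> (u has_real_derivative u' t) (at t)"
      "\<And>t. a < t \<Longrightarrow> t < b \<Longrightarrow> (w has_real_derivative w' t) (at t)"
      "\<And>t. a < t \<Longrightarrow> t < b \<Longrightarrow> (y has_real_derivative u t * x' t) (at t)"
      "\<And>t. a < t \<Longrightarrow> t < b \<Longrightarrow> (v has_real_derivative w t * u' t) (at t)"
      "\<And>t. a < t \<Longrightarrow> t < b \<Longrightarrow> (z has_real_derivative v t * x' t) (at t)"
    and deriv_pos: "\<And>t. a < t \<Longrightarrow> t < b \<Longrightarrow> x' t > 0"
      "\<And>t. a < t \<Longrightarrow> t < b \<Longrightarrow> u' t > 0"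
      "\<And>t. a < t \<Longrightarrow> t < b \<Longrightarrow> w' t > 0"
begin

text \<open>\<open>X s t, Y s t, Z s t\<close> are the coordinates of the increment from \<open>s\<close> to \<open>t\<close> in the flag at
  \<open>s\<close>; the rows \<open>(1, X, Y, Z)\<close>, \<open>(0, 1, U, V)\<close>, \<open>(0, 0, 1, W)\<close>, \<open>(0, 0, 0, 1)\<close> express the point
  and the flag at \<open>t\<close> through those at \<open>s\<close>. Multiplicativity of these matrices is
  \<open>increment_trans\<close>.\<close>

definition "X s t = x t - x s"
definition "U s t = u t - u s"
definition "W s t = w t - w s"
definition "Y s t = y t - y s - u s * X s t"
definition "V s t = v t - v s - w s * U s t"
definition "Z s t = z t - z s - v s * X s t - w s * Y s t"

definition "minor_XV s t = X s t * V s t - Z s t"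
definition "minor_YV s t = Y s t * V s t - U s t * Z s t"
definition "minor_YW s t = Y s t * W s t - Z s t"

lemmas increment_defs = X_def U_def W_def Y_def V_def Z_def

lemmas minor_defs = minor_XV_def minor_YV_def minor_YW_def

lemma increment_trans:
  "X s t = X s m + X m t"
  "U s t = U s m + U m t"
  "W s t = W s m + W m t"
  "Y s t = Y s m + Y m t + U s m * X m t"
  "V s t = V s m + V m t + W s m * U m t"
  "Z s t = Z s m + Z m t + V s m * X m t + W s m * Y m t"
  by (simp_all add: increment_defs algebra_simps)

lemma increment_self [simp]: "X s s = 0" "U s s = 0" "W s s = 0" "Y s s = 0" "V s s = 0" "Z s s = 0"
  by (simp_all add: increment_defs)

lemma increment_swap:
  "X t s = - X s t"
  "U t s = - U s t"
  "W t s = - W s t"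
  "Y t s = X s t * U s t - Y s t"
  "V t s = U s t * W s t - V s t"
  "Z t s = Y s t * W s t - Z s t - X s t * V t s"
  by (simp_all add: increment_defs algebra_simps)

lemma continuous_on_increment:
  "continuous_on {a..b} (X s)" "continuous_on {a..b} (U s)" "continuous_on {a..b} (W s)"
  "continuous_on {a..b} (Y s)" "continuous_on {a..b} (V s)" "continuous_on {a..b} (Z s)"
  unfolding increment_defs[abs_def] by (intro continuous_intros cont)+

lemma deriv_increment:
  assumes "a < t" "t < b"
  shows "(X s has_real_derivative x' t) (at t)" "(U s has_real_derivative u' t) (at t)"
    "(W s has_real_derivative w' t) (at t)" "(Y s has_real_derivative U s t * x' t) (at t)"
    "(V s has_real_derivative W s t * u' t) (at t)" "(Z s has_real_derivative V s t * x' t) (at t)"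
  unfolding increment_defs[abs_def]
  by (auto intro!: derivative_eq_intros deriv assms simp: algebra_simps)

lemma increment_pos:
  assumes "a \<le> s" "s < t" "t \<le> b"
  shows "X s t > 0" "U s t > 0" "W s t > 0" "Y s t > 0" "V s t > 0" "Z s t > 0"
    "minor_XV s t > 0"
proof -
  note pos = pos_if_deriv_pos[OF _ _ _ _ assms(1)]
  have XUW: "X s t > 0" "U s t > 0" "W s t > 0" if "s < t" "t \<le> b" for t
    using pos[OF continuous_on_increment(1) _ deriv_increment(1)]
      pos[OF continuous_on_increment(2) _ deriv_increment(2)]
      pos[OF continuous_on_increment(3) _ deriv_increment(3)] deriv_pos assms(1) that by auto
  moreover have "Y s t > 0"
    using pos[OF continuous_on_increment(4) _ deriv_increment(4)] deriv_pos XUW assms by auto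
  moreover have V: "V s t > 0" if "s < t" "t \<le> b" for t
    using pos[OF continuous_on_increment(5) _ deriv_increment(5)] deriv_pos XUW assms(1) that by auto
  moreover have "Z s t > 0"
    using pos[OF continuous_on_increment(6) _ deriv_increment(6)] deriv_pos V assms by auto
  moreover have "minor_XV s t > 0"
  proof (rule pos[OF _ _ _ _ assms(2,3)])
    show "continuous_on {a..b} (minor_XV s)"
      unfolding minor_XV_def[abs_def] by (intro continuous_intros continuous_on_increment)
    show "(minor_XV s has_real_derivative X s t * (W s t * u' t)) (at t)" if "a < t" "t < b" for t
      unfolding minor_XV_def[abs_def] using that
      by (auto intro!: derivative_eq_intros deriv_increment simp: algebra_simps)
    show "X s t * (W s t * u' t) > 0" if "s < t" "t < b" for t
      using that XUW deriv_pos assms(1) by auto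
  qed (simp add: minor_XV_def)
  ultimately show "X s t > 0" "U s t > 0" "W s t > 0" "Y s t > 0" "V s t > 0" "Z s t > 0"
    "minor_XV s t > 0" using assms by auto
qed

end

lemma (in integral_chain) restrict:
  assumes "a \<le> s" "s < t" "t \<le> b"
  shows "integral_chain s t x y z u v w x' u' w'"
  by unfold_locales (use assms cont deriv deriv_pos in \<open>auto elim!: continuous_on_subset\<close>)

lemma (in integral_chain) reverse:
  "integral_chain (- b) (- a) (\<lambda>t. - x (- t)) (\<lambda>t. y (- t)) (\<lambda>t. - z (- t))
     (\<lambda>t. - u (- t)) (\<lambda>t. v (- t)) (\<lambda>t. - w (- t)) (\<lambda>t. x' (- t)) (\<lambda>t. u' (- t)) (\<lambda>t. w' (- t))"
proof
  have reflect: "continuous_on {- b..- a} (\<lambda>t. h (- t))" if "continuous_on {a..b} h"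
    for h :: "real \<Rightarrow> real"
    by (rule continuous_on_compose2[OF that]) (auto intro!: continuous_intros)
  show "continuous_on {- b..- a} (\<lambda>t. - x (- t))" "continuous_on {- b..- a} (\<lambda>t. y (- t))"
    "continuous_on {- b..- a} (\<lambda>t. - z (- t))" "continuous_on {- b..- a} (\<lambda>t. - u (- t))"
    "continuous_on {- b..- a} (\<lambda>t. v (- t))" "continuous_on {- b..- a} (\<lambda>t. - w (- t))"
    by (intro continuous_on_minus reflect cont)+
  fix t assume "- b < t" "t < - a"
  then have inside: "a < - t" "- t < b" by auto
  show "x' (- t) > 0" "u' (- t) > 0" "w' (- t) > 0" using deriv_pos inside by auto
  note deriv_reflect = deriv[OF inside, unfolded DERIV_mirror]
  show "((\<lambda>t. - x (- t)) has_real_derivative x' (- t)) (at t)"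
    "((\<lambda>t. - u (- t)) has_real_derivative u' (- t)) (at t)"
    "((\<lambda>t. - w (- t)) has_real_derivative w' (- t)) (at t)"
    "((\<lambda>t. y (- t)) has_real_derivative - u (- t) * x' (- t)) (at t)"
    "((\<lambda>t. v (- t)) has_real_derivative - w (- t) * u' (- t)) (at t)"
    "((\<lambda>t. - z (- t)) has_real_derivative v (- t) * x' (- t)) (at t)"
    by (auto intro!: derivative_eq_intros deriv_reflect)
qed (simp add: a_less_b)

text \<open>These are the coordinates of the osculating planes.\<close>

lemma (in integral_chain) dual:
  "integral_chain a b w (\<lambda>t. u t * w t - v t) (\<lambda>t. x t * (u t * w t - v t) - y t * w t + z t)
     u (\<lambda>t. x t * u t - y t) x w' u' x'"
proof
  show "continuous_on {a..b} (\<lambda>t. u t * w t - v t)" "continuous_on {a..b} (\<lambda>t. x t * u t - y t)"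
    "continuous_on {a..b} (\<lambda>t. x t * (u t * w t - v t) - y t * w t + z t)"
    by (intro continuous_intros cont)+
  fix t assume t: "a < t" "t < b"
  show "((\<lambda>t. u t * w t - v t) has_real_derivative u t * w' t) (at t)"
    "((\<lambda>t. x t * u t - y t) has_real_derivative x t * u' t) (at t)"
    "((\<lambda>t. x t * (u t * w t - v t) - y t * w t + z t) has_real_derivative
      (x t * u t - y t) * w' t) (at t)"
    by (auto intro!: derivative_eq_intros deriv t simp: algebra_simps)
qed (use cont deriv deriv_pos a_less_b in auto)

context integral_chain
begin

interpretation rev: integral_chain "- b" "- a" "\<lambda>t. - x (- t)" "\<lambda>t. y (- t)" "\<lambda>t. - z (- t)"
  "\<lambda>t. - u (- t)" "\<lambda>t. v (- t)" "\<lambda>t. - w (- t)" "\<lambda>t. x' (- t)" "\<lambda>t. u' (- t)" "\<lambda>t. w' (- t)"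
  by (rule reverse)

lemma reverse_increment:
  "rev.X (- s) (- t) = X t s" "rev.U (- s) (- t) = U t s" "rev.W (- s) (- t) = W t s"
  "rev.Y (- s) (- t) = Y s t" "rev.V (- s) (- t) = V s t" "rev.Z (- s) (- t) = - Z s t"
  unfolding rev.increment_defs increment_defs by (simp_all add: algebra_simps)

lemma increment_swap_pos:
  assumes "a \<le> s" "s < t" "t \<le> b"
  shows "Y t s > 0" "V t s > 0" "Z t s < 0" "minor_YW s t > 0"
  using rev.increment_pos[of "- t" "- s"] increment_swap(1,6)[of t s] assms
  by (simp_all add: reverse_increment rev.minor_XV_def minor_YW_def)

end

context integral_chain
begin

text \<open>\<open>vol s m n t\<close> is the determinant of the increments from \<open>s\<close> to \<open>m\<close>, \<open>n\<close> and \<open>t\<close>. Heights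
  over the plane through the tangent at \<open>s\<close> and the point at \<open>t\<close> are measured by
  \<open>chord_height s t m\<close> for the point at \<open>m\<close> and by \<open>chord_slope s t m\<close> for the vector \<open>T m\<close>. The tangent at \<open>s\<close>
  meets the osculating plane at \<open>t\<close> at parameter \<open>- vertex_param t s\<close>, and
  \<open>vertex_height s t m / V t s\<close> is the height of that point over the osculating plane at \<open>m\<close>.

  The identities in the proofs below come from expanding the increment over \<open>[s, t]\<close> through
  intermediate parameters and collecting minors of the factors, as in the Cauchy-Binet formula.\<close>

definition "vol s m n t =
  X s m * (Y s n * Z s t - Z s n * Y s t) - Y s m * (X s n * Z s t - Z s n * X s t)
    + Z s m * (X s n * Y s t - Y s n * X s t)"

definition "chord_height s t m = Y s m * Z s t - Z s m * Y s t"
definition "chord_slope s t m = U s m * Z s t - V s m * Y s t"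
definition "vertex_param s t = Z s t / V s t"
definition "vertex_height s t m = Z m s * V t s - Z t s * V m s"

lemma minor_YV_pos:
  assumes "a \<le> s" "s < t" "t \<le> b"
  shows "minor_YV s t > 0"
proof (rule pos_if_deriv_pos[OF _ _ _ _ assms])
  show "continuous_on {a..b} (minor_YV s)"
    unfolding minor_YV_def[abs_def] by (intro continuous_intros continuous_on_increment)
  show "(minor_YV s has_real_derivative minor_YW s t * u' t) (at t)" if "a < t" "t < b" for t
    unfolding minor_YV_def[abs_def] minor_YW_def using that
    by (auto intro!: derivative_eq_intros deriv_increment simp: algebra_simps)
  show "minor_YW s t * u' t > 0" if "s < t" "t < b" for t
    using that assms(1) increment_swap_pos(4) deriv_pos(2) by simp
qed (simp add: minor_YV_def)

lemma minor_YV_commute: "minor_YV t s = minor_YV s t"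
  by (simp add: minor_YV_def increment_swap[of t s] algebra_simps)

lemma vol_pos:
  assumes "a \<le> s" "s < m" "m < n" "n < t" "t \<le> b"
  shows "vol s m n t > 0"
proof -
  have "vol s m n t =
      X s m * (X n t * minor_YV m n + Y n t * minor_YW m n + Y m n * Z n t)
    + Y m s * (X n t * minor_XV m n + X m n * Y n t * W m n + X m n * Z n t)
    + (- Z m s) * (X n t * Y n m + X m n * Y n t)"
    by (simp add: vol_def minor_defs increment_trans[of s t n] increment_trans[of s n m]
        increment_swap[of m s] increment_swap[of n m] algebra_simps)
  also have "\<dots> > 0"
    using increment_pos[of s m] increment_pos[of m n] increment_pos[of n t] minor_YV_pos[of m n]
      increment_swap_pos[of s m] increment_swap_pos[of m n] assms
    by (intro add_pos_pos mult_pos_pos) auto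
  finally show ?thesis .
qed

lemma Z_strict_mono:
  assumes "a \<le> s" "s < m" "m < n" "n \<le> b"
  shows "Z s m < Z s n"
proof -
  have "Z s n - Z s m = Z m n + V s m * X m n + W s m * Y m n"
    by (simp add: increment_trans(6)[of s n m])
  also have "\<dots> > 0"
    using increment_pos[of s m] increment_pos[of m n] assms by (simp add: add_pos_pos)
  finally show ?thesis by simp
qed

lemma slope_ratio_strict_mono:
  assumes "a \<le> s" "s < m" "m < n" "n \<le> b"
  shows "V s m * U s n < V s n * U s m"
proof -
  have "V s n * U s m - V s m * U s n = V m n * U s m + U m n * V m s"
    by (simp add: increment_trans[of s n m] increment_swap[of m s] algebra_simps)
  also have "\<dots> > 0"
    using increment_pos[of s m] increment_pos[of m n] increment_swap_pos[of s m] assms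
    by (simp add: add_pos_pos)
  finally show ?thesis by simp
qed

lemma minor_ratio_strict_mono:
  assumes "a \<le> s" "s < m" "m < t" "t \<le> b"
  shows "minor_YV s m * minor_XV s t < minor_YV s t * minor_XV s m"
proof -
  have "minor_YV s t * minor_XV s m - minor_YV s m * minor_XV s t =
      U m t * (Z s m * (- Z m s)) + V m t * (Z s m * Y m s) + Y t m * (V s m * (- Z m s))
    + minor_XV m t * (V s m * Y m s) + minor_YV m t * minor_XV s m"
    by (simp add: minor_defs increment_trans[of s t m] increment_swap[of m s]
        increment_swap[of t m] algebra_simps)
  also have "\<dots> > 0"
    using increment_pos[of s m] increment_pos[of m t] increment_swap_pos[of s m]
      increment_swap_pos[of m t] minor_YV_pos[of m t] assms
    by (intro add_pos_pos mult_pos_pos) auto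
  finally show ?thesis by simp
qed

lemma chord_height_pos:
  assumes "a \<le> s" "s < m" "m < t" "t \<le> b"
  shows "chord_height s t m > 0"
proof -
  have "chord_height s t m =
      Y s m * Z m t + X m t * minor_YV s m + Y m t * minor_YW s m"
    by (simp add: chord_height_def minor_defs increment_trans[of s t m] algebra_simps)
  also have "\<dots> > 0"
    using increment_pos[of s m] increment_pos[of m t] increment_swap_pos[of s m]
      minor_YV_pos[of s m] assms
    by (simp add: add_pos_pos)
  finally show ?thesis .
qed

lemma chord_slope_neg:
  assumes "a \<le> s" "s < m" "m < n" "n < t" "t \<le> b" and "chord_slope s t m \<le> 0"
  shows "chord_slope s t n < 0"
proof -
  have pos: "U s m > 0" "U s n > 0" "Y s t > 0" using increment_pos assms by auto
  have "U s m * (U s n * Z s t) = U s n * (U s m * Z s t)" by simp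
  also have "\<dots> \<le> U s n * (V s m * Y s t)"
    using assms(6) pos(2) by (simp add: chord_slope_def)
  also have "\<dots> = V s m * U s n * Y s t" by simp
  also have "\<dots> < V s n * U s m * Y s t"
    using slope_ratio_strict_mono assms(1-5) pos(3) by simp
  finally have "U s m * (U s n * Z s t) < U s m * (V s n * Y s t)" by (simp add: mult_ac)
  then show ?thesis using pos(1) by (simp add: chord_slope_def)
qed

lemma chord_height_swap:
  "chord_height t s m = Y s m * minor_XV s t - X s m * minor_YV s t - Z s m * Y t s"
  by (simp add: chord_height_def minor_defs increment_trans[of t m s] increment_swap[of t s]
      algebra_simps)

lemma chord_slope_swap:
  "chord_slope t s m = U s m * minor_XV s t - minor_YV s t - V s m * Y t s"
  by (simp add: chord_slope_def minor_defs increment_trans[of t m s] increment_swap[of t s]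
      algebra_simps)

lemma chord_height_ratio:
  assumes "a \<le> s" "s < m" "m < n" "n < t" "t \<le> b"
  shows "chord_height s t m * (- chord_height t s n) < chord_height s t n * (- chord_height t s m)"
proof -
  have "chord_height s t n * (- chord_height t s m) - chord_height s t m * (- chord_height t s n)
     = minor_YV s t * vol s m n t"
    by (simp add: chord_height_swap[of t s] chord_height_def[of s t] minor_defs vol_def
        increment_swap[of t s] algebra_simps)
  also have "\<dots> > 0" using minor_YV_pos vol_pos assms by simp
  finally show ?thesis by simp
qed

end

context integral_chain
begin

interpretation rev: integral_chain "- b" "- a" "\<lambda>t. - x (- t)" "\<lambda>t. y (- t)" "\<lambda>t. - z (- t)"
  "\<lambda>t. - u (- t)" "\<lambda>t. v (- t)" "\<lambda>t. - w (- t)" "\<lambda>t. x' (- t)" "\<lambda>t. u' (- t)" "\<lambda>t. w' (- t)"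
  by (rule reverse)

lemma chord_height_neg:
  assumes "a \<le> s" "s < m" "m < t" "t \<le> b"
  shows "chord_height t s m < 0"
  using rev.chord_height_pos[of "- t" "- m" "- s"] assms
  by (simp add: rev.chord_height_def chord_height_def reverse_increment)

lemma chord_slope_pos:
  assumes "a \<le> s" "s < m" "m < n" "n < t" "t \<le> b" and "chord_slope t s m \<ge> 0"
  shows "chord_slope t s n > 0"
proof -
  have "rev.chord_slope (- t) (- s) (- k) = chord_slope t s k" for k
    by (simp add: rev.chord_slope_def chord_slope_def reverse_increment increment_swap(2)[of k t])
  then show ?thesis using rev.chord_slope_neg[of "- t" "- n" "- m" "- s"] assms by fastforce
qed

lemma Z_swap_strict_mono:
  assumes "a \<le> m" "m < n" "n < t" "t \<le> b"
  shows "Z t m < Z t n"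
  using rev.Z_strict_mono[of "- t" "- n" "- m"] assms by (simp add: reverse_increment)

end

context integral_chain
begin

interpretation dual: integral_chain a b w "\<lambda>t. u t * w t - v t"
  "\<lambda>t. x t * (u t * w t - v t) - y t * w t + z t" u "\<lambda>t. x t * u t - y t" x w' u' x'
  by (rule dual)

lemma dual_increment:
  "dual.X s t = W s t" "dual.U s t = U s t" "dual.W s t = X s t"
  "dual.Y s t = V t s" "dual.V s t = Y t s" "dual.Z s t = - Z t s"
  unfolding dual.increment_defs increment_defs by (simp_all add: algebra_simps)

lemma vertex_height_eq_dual: "vertex_height s t m = dual.chord_height s t m"
  by (simp add: vertex_height_def dual.chord_height_def dual_increment)

lemma vertex_height_sign:
  assumes "a \<le> s" "s < m" "m < t" "t \<le> b"
  shows "vertex_height s t m > 0" "vertex_height t s m < 0"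
  using dual.chord_height_pos dual.chord_height_neg assms by (simp_all add: vertex_height_eq_dual)

lemma vertex_height_ratio:
  assumes "a \<le> s" "s < m" "m < n" "n < t" "t \<le> b"
  shows "vertex_height s t m * (- vertex_height t s n)
    < vertex_height s t n * (- vertex_height t s m)"
  using dual.chord_height_ratio[OF assms] by (simp add: vertex_height_eq_dual)

lemma vertex_param_sign:
  assumes "a \<le> s" "s < t" "t \<le> b"
  shows "vertex_param s t > 0" "vertex_param t s < 0"
  using increment_pos[OF assms] increment_swap_pos[OF assms]
  by (simp_all add: vertex_param_def divide_neg_pos)

lemma vertex_param_less:
  assumes "a \<le> t" "t < m" "m < n" "n \<le> b"
  shows "vertex_param n t < vertex_param m t"
proof -
  have "V m t > 0" "V n t > 0" using increment_swap_pos(2)[of t] assms by auto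
  then show ?thesis
    using vertex_height_sign(1)[of t m n] assms
    by (simp add: vertex_height_def vertex_param_def field_simps)
qed

lemma vertex_param_swap_less:
  assumes "a \<le> m" "m < n" "n < t" "t \<le> b"
  shows "vertex_param n t < vertex_param m t"
proof -
  have "V m t > 0" "V n t > 0" using increment_pos(5)[of _ t] assms by auto
  then show ?thesis
    using vertex_height_sign(2)[of m n t] assms
    by (simp add: vertex_height_def vertex_param_def field_simps)
qed

end

section \<open>Planes, lines and simplices\<close>

lemma affine_hull_eq_UNIV:
  fixes S :: "'a::euclidean_space set"
  assumes "\<And>n c. (\<And>p. p \<in> S \<Longrightarrow> n \<bullet> p = c) \<Longrightarrow> n = 0"
  shows "affine hull S = UNIV"
proof (rule ccontr)
  assume "affine hull S \<noteq> UNIV"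
  then have "aff_dim S < DIM('a)" using aff_dim_eq_full[of S] aff_dim_le_DIM[of S] by linarith
  then obtain n c where "n \<noteq> 0" "S \<subseteq> {p. n \<bullet> p = c}" by (rule aff_lowdim_subset_hyperplane)
  then show False using assms[of n c] by blast
qed

lemma not_coplanar_if_affine_hull_UNIV:
  fixes S :: "(real ^ 3) set"
  assumes "affine hull S = UNIV"
  shows "\<not> coplanar S"
proof
  assume "coplanar S"
  then obtain u v w where "S \<subseteq> affine hull {u, v, w}" unfolding coplanar_def by blast
  then have "aff_dim (affine hull S) \<le> aff_dim {u, v, w}"
    using aff_dim_subset[of S "affine hull {u, v, w}"] by simp
  also have "\<dots> \<le> int (card {u, v, w}) - 1" using aff_dim_le_card[of "{u, v, w}"] by simp
  also have "\<dots> \<le> 2" by (simp add: card_insert_if)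
  finally show False using assms by simp
qed

lemma affine_hull_facet:
  fixes n p v :: "'a::euclidean_space"
  assumes "affine hull (insert v S) = UNIV"
    and "\<And>q. q \<in> S \<Longrightarrow> n \<bullet> (q - p) = 0" "n \<bullet> (v - p) \<noteq> 0" "S \<noteq> {}"
  shows "affine hull S = {q. n \<bullet> (q - p) = 0}"
proof (rule affine_dim_equal)
  have plane: "{q. n \<bullet> (q - p) = 0} = {q. n \<bullet> q = n \<bullet> p}" by (auto simp: inner_diff_right)
  show "affine {q. n \<bullet> (q - p) = 0}" unfolding plane by (rule affine_hyperplane)
  then show sub: "affine hull S \<subseteq> {q. n \<bullet> (q - p) = 0}" using assms(2) by (intro hull_minimal) auto
  then have "v \<notin> affine hull S" using assms(3) by auto
  then have "aff_dim (insert v S) = aff_dim S + 1" by (simp add: aff_dim_insert)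
  moreover have "aff_dim (insert v S) = DIM('a)" using assms(1) by (simp add: aff_dim_eq_full)
  moreover have "n \<noteq> 0" using assms(3) by auto
  then have "aff_dim {q. n \<bullet> (q - p) = 0} = DIM('a) - 1" unfolding plane by simp
  ultimately show "aff_dim (affine hull S) = aff_dim {q. n \<bullet> (q - p) = 0}" by simp
qed (use assms in auto)

lemma affine_hull_exchange:
  fixes n p v q :: "'a::euclidean_space"
  assumes "affine hull (insert v S) = UNIV"
    and "\<And>q. q \<in> S \<Longrightarrow> n \<bullet> (q - p) = 0" "n \<bullet> (v - p) \<noteq> 0" "S \<noteq> {}" "n \<bullet> (q - p) \<noteq> 0"
  shows "affine hull (insert q S) = UNIV"
proof -
  have hull: "affine hull S = {q. n \<bullet> (q - p) = 0}" by (rule affine_hull_facet[OF assms(1-4)])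
  then have "q \<notin> affine hull S" "v \<notin> affine hull S" using assms(3,5) by auto
  then have "aff_dim (insert q S) = aff_dim (insert v S)" by (simp add: aff_dim_insert)
  also have "\<dots> = DIM('a)" using assms(1) by (simp add: aff_dim_eq_full)
  finally show ?thesis by (simp add: aff_dim_eq_full)
qed

lemma in_convex_hull_if_facets:
  fixes S :: "'a::euclidean_space set"
  assumes "finite S" "affine hull S = UNIV"
    and facet: "\<And>v. v \<in> S \<Longrightarrow> \<exists>n p. (\<forall>q\<in>S - {v}. n \<bullet> (q - p) = 0) \<and> n \<bullet> (v - p) \<noteq> 0 \<and>
      0 \<le> (n \<bullet> (m - p)) / (n \<bullet> (v - p))"
  shows "m \<in> convex hull S"
proof -
  have "m \<in> affine hull S" using assms(2) by simp
  then obtain k where k: "sum k S = 1" "(\<Sum>q\<in>S. k q *\<^sub>R q) = m"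
    using affine_hull_finite[OF assms(1)] by auto
  have "k v \<ge> 0" if v: "v \<in> S" for v
  proof -
    obtain n p where n: "\<forall>q\<in>S - {v}. n \<bullet> (q - p) = 0" "n \<bullet> (v - p) \<noteq> 0"
      "0 \<le> (n \<bullet> (m - p)) / (n \<bullet> (v - p))"
      using facet[OF v] by blast
    have "m - p = (\<Sum>q\<in>S. k q *\<^sub>R (q - p))"
      using k by (simp add: scaleR_diff_right sum_subtractf flip: scaleR_sum_left)
    then have "n \<bullet> (m - p) = (\<Sum>q\<in>S. k q * (n \<bullet> (q - p)))" by (simp add: inner_sum_right)
    also have "\<dots> = k v * (n \<bullet> (v - p))"
      using n(1) by (simp add: sum.remove[OF assms(1) v])
    finally show ?thesis using n(2,3) by simp
  qed
  then show ?thesis unfolding convex_hull_finite[OF assms(1)] using k by blast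
qed

lemma plane_Int_line:
  fixes n c p q :: "'a::euclidean_space"
  assumes "n \<bullet> (p - c) = \<alpha>" "n \<bullet> (q - c) = - \<beta>" "\<alpha> + \<beta> \<noteq> 0"
  shows "{m. n \<bullet> (m - c) = 0} \<inter> affine hull {p, q} = {p + (\<alpha> / (\<alpha> + \<beta>)) *\<^sub>R (q - p)}"
proof -
  have height: "n \<bullet> (p + k *\<^sub>R (q - p) - c) = \<alpha> - k * (\<alpha> + \<beta>)" for k
  proof -
    have "p + k *\<^sub>R (q - p) - c = (1 - k) *\<^sub>R (p - c) + k *\<^sub>R (q - c)" by (simp add: algebra_simps)
    then show ?thesis
      by (simp only: inner_add_right inner_scaleR_right assms(1,2)) (simp add: algebra_simps)
  qed
  have "n \<bullet> (p + k *\<^sub>R (q - p) - c) = 0 \<longleftrightarrow> k = \<alpha> / (\<alpha> + \<beta>)" for k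
    unfolding height using assms(3) by (auto simp: field_simps)
  moreover have "affine hull {p, q} = range (\<lambda>k. p + k *\<^sub>R (q - p))"
    by (rule affine_hull_2_alt)
  ultimately show ?thesis by (auto simp only: Int_iff mem_Collect_eq image_iff singleton_iff)
qed

lemma plane_through_edge:
  fixes c d p q m n n' :: "real ^ 3"
  assumes full: "affine hull {c, d, p, q} = UNIV"
    and n: "n \<bullet> (c - p) = 0" "n \<bullet> (d - p) = 0" "n \<bullet> (q - p) \<noteq> 0"
    and n': "n' \<bullet> (c - q) = 0" "n' \<bullet> (d - q) = 0" "n' \<bullet> (p - q) \<noteq> 0"
    and m: "n \<bullet> (m - p) / (n \<bullet> (q - p)) = \<alpha>" "n' \<bullet> (m - q) / (n' \<bullet> (p - q)) = \<beta>" "\<alpha> > 0" "\<beta> > 0"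
  shows "\<not> collinear {c, d, m}"
    and "affine hull {c, d, m} \<inter> affine hull {p, q} = {p + (\<alpha> / (\<alpha> + \<beta>)) *\<^sub>R (q - p)}"
proof -
  \<comment> \<open>the plane through \<open>m\<close> in the pencil spanned by the planes with normals \<open>n\<close> and \<open>n'\<close>\<close>
  define f where "f = (\<beta> / (n \<bullet> (q - p))) *\<^sub>R n - (\<alpha> / (n' \<bullet> (p - q))) *\<^sub>R n'"
  have "n \<bullet> (c' - c) = n \<bullet> (c' - p)" "n' \<bullet> (c' - c) = n' \<bullet> (c' - q)" for c'
    using n(1) n'(1) by (simp_all add: inner_diff_right)
  then have f: "f \<bullet> (c' - c) =
      \<beta> * (n \<bullet> (c' - p) / (n \<bullet> (q - p))) - \<alpha> * (n' \<bullet> (c' - q) / (n' \<bullet> (p - q)))" for c'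
    by (simp add: f_def inner_diff_left)
  have fc: "f \<bullet> (d - c) = 0" "f \<bullet> (m - c) = 0" "f \<bullet> (p - c) = - \<alpha>" "f \<bullet> (q - c) = \<beta>"
    unfolding f using n n' m by auto
  have "affine hull (insert m {p, c, d}) = UNIV"
  proof (rule affine_hull_exchange)
    show "affine hull (insert q {p, c, d}) = UNIV" using full by (simp add: insert_commute)
    show "n \<bullet> (q' - p) = 0" if "q' \<in> {p, c, d}" for q' using that n by auto
    show "n \<bullet> (m - p) \<noteq> 0" using m(1,3) by auto
  qed (use n in auto)
  then have "affine hull (insert p {c, d, m}) = UNIV" by (simp add: insert_commute)
  then have hull: "affine hull {c, d, m} = {c'. f \<bullet> (c' - c) = 0}"
    by (rule affine_hull_facet) (use fc m(3) in auto)
  have "p \<notin> affine hull {c, d, m}" unfolding hull using fc m(3) by auto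
  then have "aff_dim {c, d, m} + 1 = aff_dim (insert p {c, d, m})"
    by (simp only: aff_dim_insert if_False)
  also have "\<dots> = 3"
    using \<open>affine hull (insert p {c, d, m}) = UNIV\<close> aff_dim_eq_full[of "insert p {c, d, m}"] by simp
  finally show "\<not> collinear {c, d, m}" by (simp add: collinear_aff_dim)
  show "affine hull {c, d, m} \<inter> affine hull {p, q} = {p + (\<alpha> / (\<alpha> + \<beta>)) *\<^sub>R (q - p)}"
    unfolding hull using plane_Int_line[of "- f" p c \<alpha> q \<beta>] fc m(3,4) by (simp add: add_pos_pos)
qed

lemma infdist_hyperplane:
  fixes n c p :: "'a::euclidean_space"
  assumes "n \<noteq> 0"
  shows "infdist p {q. n \<bullet> (q - c) = 0} = \<bar>n \<bullet> (p - c)\<bar> / norm n"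
proof (rule antisym)
  let ?foot = "p - (n \<bullet> (p - c) / (n \<bullet> n)) *\<^sub>R n"
  have "?foot \<in> {q. n \<bullet> (q - c) = 0}" using assms by (simp add: inner_diff_right)
  then have "infdist p {q. n \<bullet> (q - c) = 0} \<le> dist p ?foot" by (rule infdist_le)
  also have "\<dots> = \<bar>n \<bullet> (p - c)\<bar> / norm n"
    by (simp add: dist_norm power2_norm_eq_inner[symmetric] power2_eq_square)
  finally show "infdist p {q. n \<bullet> (q - c) = 0} \<le> \<bar>n \<bullet> (p - c)\<bar> / norm n" .
next
  have "\<bar>n \<bullet> (p - c)\<bar> / norm n \<le> dist p q" if "n \<bullet> (q - c) = 0" for q
  proof -
    have "n \<bullet> (p - c) = n \<bullet> (p - q)" using that by (simp add: inner_diff_right)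
    also have "\<bar>\<dots>\<bar> \<le> norm n * norm (p - q)" by (rule Cauchy_Schwarz_ineq2)
    finally show ?thesis using assms by (simp add: dist_norm field_simps)
  qed
  moreover have "{q. n \<bullet> (q - c) = 0} \<noteq> {}" by (auto intro: exI[of _ c])
  ultimately show "\<bar>n \<bullet> (p - c)\<bar> / norm n \<le> infdist p {q. n \<bullet> (q - c) = 0}"
    by (auto simp: infdist_notempty intro!: cINF_greatest)
qed

lemma parallel_to_plane_iff:
  "parallel_to_plane d {p. n \<bullet> (p - c) = 0} \<longleftrightarrow> n \<bullet> d = 0"
proof
  show "n \<bullet> d = 0" if "parallel_to_plane d {p. n \<bullet> (p - c) = 0}"
    using that by (auto simp: parallel_to_plane_def inner_add_right inner_diff_right)
  show "parallel_to_plane d {p. n \<bullet> (p - c) = 0}" if "n \<bullet> d = 0"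
    unfolding parallel_to_plane_def using that by (intro bexI[of _ c]) auto
qed

lemma strictly_monotone_on_dist_ray:
  fixes d :: "real ^ 3"
  assumes "d \<noteq> 0" "\<And>t. t \<in> S \<Longrightarrow> k t \<ge> 0" "\<And>s t. s \<in> S \<Longrightarrow> t \<in> S \<Longrightarrow> s < t \<Longrightarrow> k s < k t"
  shows "strictly_monotone_on S (\<lambda>t. dist p (p + k t *\<^sub>R d))"
proof -
  have "dist p (p + k t *\<^sub>R d) = k t * norm d" if "t \<in> S" for t
    using assms(2)[OF that] by (simp add: dist_norm)
  then show ?thesis using assms unfolding strictly_monotone_on_def by auto
qed

lemma strictly_monotone_on_dist_barycentric:
  fixes p q :: "real ^ 3"
  assumes "p \<noteq> q" "\<And>t. t \<in> S \<Longrightarrow> \<alpha> t > 0" "\<And>t. t \<in> S \<Longrightarrow> \<beta> t > 0"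
    and "\<And>s t. s \<in> S \<Longrightarrow> t \<in> S \<Longrightarrow> s < t \<Longrightarrow> \<alpha> s * \<beta> t < \<alpha> t * \<beta> s"
  shows "strictly_monotone_on S (\<lambda>t. dist p (p + (\<alpha> t / (\<alpha> t + \<beta> t)) *\<^sub>R (q - p)))"
proof (rule strictly_monotone_on_dist_ray)
  show "\<alpha> t / (\<alpha> t + \<beta> t) \<ge> 0" if "t \<in> S" for t
    using assms(2,3)[OF that] by simp
  show "\<alpha> s / (\<alpha> s + \<beta> s) < \<alpha> t / (\<alpha> t + \<beta> t)" if "s \<in> S" "t \<in> S" "s < t" for s t
    using assms(4)[OF that] assms(2,3)[OF that(1)] assms(2,3)[OF that(2)]
    by (simp add: divide_less_eq less_divide_eq algebra_simps add_pos_pos)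
qed (use assms in simp)

lemma unique_max_if_deriv_sign:
  fixes h h' :: "real \<Rightarrow> real"
  assumes "a < b" "continuous_on {a..b} h" "h a = h b"
    and deriv: "\<And>t. a < t \<Longrightarrow> t < b \<Longrightarrow> (h has_real_derivative h' t) (at t)"
    and sign: "\<And>s t. a < s \<Longrightarrow> s < t \<Longrightarrow> t < b \<Longrightarrow> h' s \<le> 0 \<Longrightarrow> h' t < 0"
  obtains c where "a < c" "c < b" "\<And>t. a < t \<Longrightarrow> t < b \<Longrightarrow> h' t = 0 \<longleftrightarrow> t = c"
    "\<And>t. a \<le> t \<Longrightarrow> t \<le> b \<Longrightarrow> t \<noteq> c \<Longrightarrow> h t < h c"
proof -
  obtain c where c: "a < c" "c < b" "(h has_real_derivative 0) (at c)"
    using Rolle[OF assms(1,3,2)] deriv real_differentiable_def by blast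
  have zero: "h' c = 0" using DERIV_unique[OF deriv[OF c(1,2)] c(3)] .
  have pos: "h' t > 0" if "a < t" "t < c" for t using sign[of t c] that c zero by fastforce
  have neg: "h' t < 0" if "c < t" "t < b" for t using sign[of c t] that c zero by auto
  have "h t < h c" if "a \<le> t" "t < c" for t
  proof (rule DERIV_pos_imp_increasing_open[OF that(2)])
    show "\<exists>l. (h has_real_derivative l) (at \<tau>) \<and> 0 < l" if "t < \<tau>" "\<tau> < c" for \<tau>
      using deriv[of \<tau>] pos[of \<tau>] that \<open>a \<le> t\<close> c by auto
  qed (use that c assms(2) in \<open>auto intro: continuous_on_subset\<close>)
  moreover have "h t < h c" if "c < t" "t \<le> b" for t
  proof (rule DERIV_neg_imp_decreasing_open[OF that(1)])
    show "\<exists>l. (h has_real_derivative l) (at \<tau>) \<and> l < 0" if "c < \<tau>" "\<tau> < t" for \<tau>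
      using deriv[of \<tau>] neg[of \<tau>] that \<open>t \<le> b\<close> c by auto
  qed (use that c assms(2) in \<open>auto intro: continuous_on_subset\<close>)
  ultimately have "h t < h c" if "a \<le> t" "t \<le> b" "t \<noteq> c" for t using that by force
  moreover have "h' t = 0 \<longleftrightarrow> t = c" if "a < t" "t < b" for t
    using pos[of t] neg[of t] zero that by force
  ultimately show ?thesis using that c(1,2) by blast
qed

lemma parallel_point_eq_farthest_point:
  fixes r r' :: "real \<Rightarrow> real ^ 3"
  assumes "a < b" "continuous_on {a..b} r" "n \<noteq> 0" "n \<bullet> (r b - r a) = 0"
    and deriv: "\<And>t. a < t \<Longrightarrow> t < b \<Longrightarrow> (r has_vector_derivative r' t) (at t)"
    and side: "\<And>t. a \<le> t \<Longrightarrow> t \<le> b \<Longrightarrow> n \<bullet> (r t - r a) \<ge> 0"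
    and sign: "\<And>s t. a < s \<Longrightarrow> s < t \<Longrightarrow> t < b \<Longrightarrow> n \<bullet> r' s \<le> 0 \<Longrightarrow> n \<bullet> r' t < 0"
  shows "\<exists>p. parallel_points r a b {q. n \<bullet> (q - r a) = 0} = {p} \<and>
    farthest_points r a b {q. n \<bullet> (q - r a) = 0} = {p}"
proof -
  let ?plane = "{q. n \<bullet> (q - r a) = 0}"
  obtain c where c: "a < c" "c < b" "\<And>t. a < t \<Longrightarrow> t < b \<Longrightarrow> n \<bullet> r' t = 0 \<longleftrightarrow> t = c"
    and max: "\<And>t. a \<le> t \<Longrightarrow> t \<le> b \<Longrightarrow> t \<noteq> c \<Longrightarrow> n \<bullet> (r t - r a) < n \<bullet> (r c - r a)"
  proof (rule unique_max_if_deriv_sign[OF assms(1)])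
    show "continuous_on {a..b} (\<lambda>t. n \<bullet> (r t - r a))" by (intro continuous_intros assms(2))
    show "((\<lambda>t. n \<bullet> (r t - r a)) has_real_derivative n \<bullet> r' t) (at t)" if "a < t" "t < b" for t
      unfolding has_real_derivative_iff_has_vector_derivative
      using bounded_linear.has_vector_derivative[OF bounded_linear_inner_right
          has_vector_derivative_diff[OF deriv[OF that] has_vector_derivative_const]] by simp
  qed (use assms(4) sign in auto)
  have "d1 r t = r' t" if "a < t" "t < b" for t
    unfolding d1_def by (rule vector_derivative_at[OF deriv[OF that]])
  then have "parallel_points r a b ?plane = {r c}"
    using c unfolding parallel_points_def parallel_to_plane_iff by auto
  moreover have dist: "infdist (r t) ?plane = n \<bullet> (r t - r a) / norm n" if "a \<le> t" "t \<le> b" for t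
    using side[OF that] by (simp add: infdist_hyperplane[OF assms(3)])
  have "farthest_points r a b ?plane = {r c}"
  proof -
    have less: "infdist (r t) ?plane < infdist (r c) ?plane" if "a \<le> t" "t \<le> b" "t \<noteq> c" for t
      using max[OF that] dist that c(1,2) assms(3) by (simp add: divide_strict_right_mono)
    then have "r c \<in> farthest_points r a b ?plane"
      using c(1,2) unfolding farthest_points_def by (force intro: less_imp_le)
    moreover have "p = r c" if "p \<in> farthest_points r a b ?plane" for p
    proof -
      from that obtain t where "a \<le> t" "t \<le> b" "p = r t"
        "infdist (r c) ?plane \<le> infdist (r t) ?plane"
        using c(1,2) unfolding farthest_points_def by auto
      then show ?thesis using less[of t] by fastforce
    qed
    ultimately show ?thesis by blast
  qed
  ultimately show ?thesis by blast
qed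

definition sweeps_line :: "real set \<Rightarrow> (real \<Rightarrow> (real ^ 3) set) \<Rightarrow> real ^ 3 \<Rightarrow> real ^ 3 \<Rightarrow> bool" where
  "sweeps_line S P p q \<longleftrightarrow> (\<exists>k. (\<forall>t\<in>S. P t \<inter> affine hull {p, q} = {k t}) \<and>
     strictly_monotone_on S (\<lambda>t. dist p (k t)))"

lemma sweeps_lineI_barycentric:
  assumes "p \<noteq> q" "\<And>t. t \<in> S \<Longrightarrow> \<alpha> t > 0" "\<And>t. t \<in> S \<Longrightarrow> \<beta> t > 0"
    and "\<And>s t. s \<in> S \<Longrightarrow> t \<in> S \<Longrightarrow> s < t \<Longrightarrow> \<alpha> s * \<beta> t < \<alpha> t * \<beta> s"
    and "\<And>t. t \<in> S \<Longrightarrow> P t \<inter> affine hull {p, q} = {p + (\<alpha> t / (\<alpha> t + \<beta> t)) *\<^sub>R (q - p)}"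
  shows "sweeps_line S P p q"
  unfolding sweeps_line_def
  by (intro exI[of _ "\<lambda>t. p + (\<alpha> t / (\<alpha> t + \<beta> t)) *\<^sub>R (q - p)"] conjI ballI assms(5)
      strictly_monotone_on_dist_barycentric assms(1-4))

lemma plane_through_edge_sweeps_line:
  fixes c d p q n n' :: "real ^ 3" and m :: "real \<Rightarrow> real ^ 3"
  defines "\<alpha> \<equiv> \<lambda>t. n \<bullet> (m t - p) / (n \<bullet> (q - p))" and "\<beta> \<equiv> \<lambda>t. n' \<bullet> (m t - q) / (n' \<bullet> (p - q))"
  assumes full: "affine hull {c, d, p, q} = UNIV"
    and n: "n \<bullet> (c - p) = 0" "n \<bullet> (d - p) = 0" "n \<bullet> (q - p) \<noteq> 0"
    and n': "n' \<bullet> (c - q) = 0" "n' \<bullet> (d - q) = 0" "n' \<bullet> (p - q) \<noteq> 0"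
    and pos: "\<And>t. t \<in> S \<Longrightarrow> \<alpha> t > 0" "\<And>t. t \<in> S \<Longrightarrow> \<beta> t > 0"
    and mono: "\<And>s t. s \<in> S \<Longrightarrow> t \<in> S \<Longrightarrow> s < t \<Longrightarrow> \<alpha> s * \<beta> t < \<alpha> t * \<beta> s"
  shows "t \<in> S \<Longrightarrow> \<not> collinear {c, d, m t}"
    and "sweeps_line S (\<lambda>t. affine hull {c, d, m t}) p q"
proof -
  have plane: "\<not> collinear {c, d, m t}"
    "affine hull {c, d, m t} \<inter> affine hull {p, q} = {p + (\<alpha> t / (\<alpha> t + \<beta> t)) *\<^sub>R (q - p)}"
    if "t \<in> S" for t
    by (rule plane_through_edge[OF full n n' _ _ pos[OF that]]; simp add: \<alpha>_def \<beta>_def)+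
  then show "t \<in> S \<Longrightarrow> \<not> collinear {c, d, m t}" by blast
  have "p \<noteq> q" using n(3) by auto
  then show "sweeps_line S (\<lambda>t. affine hull {c, d, m t}) p q"
    by (rule sweeps_lineI_barycentric[OF _ pos mono plane(2)])
qed

lemma affine_hull_2_ray:
  fixes p d :: "'a::real_vector"
  assumes "k \<noteq> 0"
  shows "affine hull {p, p + k *\<^sub>R d} = {p + c *\<^sub>R d | c. True}"
proof -
  have "affine hull {p, p + k *\<^sub>R d} = range (\<lambda>c. p + (c * k) *\<^sub>R d)"
    by (simp add: affine_hull_2_alt)
  moreover have "p + c *\<^sub>R d = p + (c / k * k) *\<^sub>R d" for c using assms by simp
  ultimately show ?thesis by blast
qed

section \<open>The tetrahedron of a framed curve\<close>

lemma cross3_Cramer: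
  "(cross3 e1 e2 \<bullet> e3) *\<^sub>R v =
    (cross3 e2 e3 \<bullet> v) *\<^sub>R e1 + (cross3 e3 e1 \<bullet> v) *\<^sub>R e2 + (cross3 e1 e2 \<bullet> v) *\<^sub>R e3"
  unfolding vec_eq_iff forall_3
  by (simp add: cross_components inner_vec_def sum_3 algebra_simps)

lemma eq_zero_if_orthogonal_to_basis:
  assumes "cross3 e1 e2 \<bullet> e3 \<noteq> 0" "n \<bullet> e1 = 0" "n \<bullet> e2 = 0" "n \<bullet> e3 = 0"
  shows "n = 0"
proof -
  have "(cross3 e1 e2 \<bullet> e3) * (n \<bullet> n) = n \<bullet> ((cross3 e1 e2 \<bullet> e3) *\<^sub>R n)" by simp
  also have "\<dots> = 0" by (subst cross3_Cramer) (use assms(2-4) in \<open>simp add: inner_add_right\<close>)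
  finally show ?thesis using assms(1) by simp
qed

locale framed_curve = integral_chain a b x y z u v w x' u' w'
  for a b x y z u v w x' u' w' +
  fixes r :: "real \<Rightarrow> real ^ 3" and origin e1 e2 e3 :: "real ^ 3"
  assumes det: "cross3 e1 e2 \<bullet> e3 \<noteq> 0"
    and curve: "\<And>t. a \<le> t \<Longrightarrow> t \<le> b \<Longrightarrow> r t = origin + x t *\<^sub>R e1 + y t *\<^sub>R e2 + z t *\<^sub>R e3"
begin

definition "T t = e1 + u t *\<^sub>R e2 + v t *\<^sub>R e3"
definition "N t = e2 + w t *\<^sub>R e3"
text \<open>Dividing both normals by the determinant of the frame makes heights polynomials in the
  increments, whatever the orientation of the frame. The vertices of the segment \<open>[s, t]\<close> with
  \<open>s < t\<close> are \<open>vertex t s\<close> on the tangent at \<open>s\<close> and \<open>vertex s t\<close> on the tangent at \<open>t\<close>.\<close>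

definition "osc_normal t = (1 / (cross3 e1 e2 \<bullet> e3)) *\<^sub>R cross3 (T t) (N t)"
definition "osc_plane t = {p. osc_normal t \<bullet> (p - r t) = 0}"
definition "tangent_line t = {r t + c *\<^sub>R T t | c. True}"
definition "chord_normal s t = (1 / (cross3 e1 e2 \<bullet> e3)) *\<^sub>R cross3 (r t - r s) (T s)"
definition "vertex s t = r t - vertex_param s t *\<^sub>R T t"
definition "tetrahedron s t = convex hull {r s, vertex t s, vertex s t, r t}"

lemma curve_diff:
  assumes "s \<in> {a..b}" "t \<in> {a..b}"
  shows "r t - r s = X s t *\<^sub>R T s + Y s t *\<^sub>R N s + Z s t *\<^sub>R e3"
  using assms curve[of s] curve[of t] by (simp add: T_def N_def increment_defs algebra_simps)

lemma T_eq: "T t = T s + U s t *\<^sub>R N s + V s t *\<^sub>R e3"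
  by (simp add: T_def N_def increment_defs algebra_simps)

lemma det_frame: "cross3 (T t) (N t) \<bullet> e3 = cross3 e1 e2 \<bullet> e3"
  by (simp add: T_def N_def cross_add_left cross_add_right cross_mult_left cross_mult_right
      inner_add_left dot_cross_self)

lemma T_nonzero: "T t \<noteq> 0"
  using det_frame[of t] det by auto

lemma osc_normal_frame [simp]:
  "osc_normal t \<bullet> T t = 0" "osc_normal t \<bullet> N t = 0" "osc_normal t \<bullet> e3 = 1"
  using det by (simp_all add: osc_normal_def dot_cross_self det_frame)

lemma osc_normal_nonzero: "osc_normal t \<noteq> 0"
proof
  assume "osc_normal t = 0"
  then have "osc_normal t \<bullet> e3 = 0" by simp
  then show False by simp
qed

lemma chord_normal_frame [simp]:
  assumes "s \<in> {a..b}" "t \<in> {a..b}"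
  shows "chord_normal s t \<bullet> T s = 0" "chord_normal s t \<bullet> N s = Z s t" "chord_normal s t \<bullet> e3 = - Y s t"
proof -
  have "cross3 (r t - r s) (T s) = Y s t *\<^sub>R cross3 (N s) (T s) + Z s t *\<^sub>R cross3 e3 (T s)"
    by (simp add: curve_diff[OF assms] cross_add_left cross_mult_left)
  moreover have "cross3 (N s) (T s) \<bullet> e3 = - (cross3 e1 e2 \<bullet> e3)"
    using cross_skew[of "N s" "T s"] det_frame[of s] by simp
  moreover have "cross3 e3 (T s) \<bullet> N s = cross3 e1 e2 \<bullet> e3"
    using cross_triple[of e3 "T s" "N s"] det_frame[of s] by simp
  ultimately show "chord_normal s t \<bullet> T s = 0" "chord_normal s t \<bullet> N s = Z s t"
    "chord_normal s t \<bullet> e3 = - Y s t"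
    using det by (simp_all add: chord_normal_def inner_add_left dot_cross_self)
qed

lemma osc_normal_T: "osc_normal s \<bullet> T t = V s t"
  by (simp add: T_eq[of t s] inner_add_right)

lemma osc_normal_curve:
  assumes "s \<in> {a..b}" "t \<in> {a..b}"
  shows "osc_normal s \<bullet> (r t - r s) = Z s t"
  by (simp add: curve_diff[OF assms] inner_add_right)

lemma chord_normal_T:
  assumes "s \<in> {a..b}" "t \<in> {a..b}"
  shows "chord_normal s t \<bullet> T m = chord_slope s t m"
  using assms by (simp add: T_eq[of m s] inner_add_right chord_slope_def)

lemma chord_normal_curve:
  assumes "s \<in> {a..b}" "t \<in> {a..b}" "m \<in> {a..b}"
  shows "chord_normal s t \<bullet> (r m - r s) = chord_height s t m"
  using assms by (simp add: curve_diff[OF assms(1,3)] inner_add_right chord_height_def)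

lemma V_pos: "s \<in> {a..b} \<Longrightarrow> t \<in> {a..b} \<Longrightarrow> s \<noteq> t \<Longrightarrow> V s t > 0"
  using increment_pos(5)[of s t] increment_swap_pos(2)[of t s] by force

lemma tangent_line_Int_osc_plane:
  assumes "s \<in> {a..b}" "t \<in> {a..b}" "s \<noteq> t"
  shows "tangent_line t \<inter> osc_plane s = {vertex s t}"
proof -
  have "osc_normal s \<bullet> (r t + c *\<^sub>R T t - r s) = Z s t + c * V s t" for c
    using osc_normal_curve[OF assms(1,2)] by (simp add: inner_diff_right inner_add_right osc_normal_T)
  then have "osc_normal s \<bullet> (r t + c *\<^sub>R T t - r s) = 0 \<longleftrightarrow> c = - vertex_param s t" for c
    using V_pos[OF assms] by (auto simp: vertex_param_def field_simps)
  moreover have "vertex s t = r t + (- vertex_param s t) *\<^sub>R T t" by (simp add: vertex_def)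
  ultimately show ?thesis by (auto simp only: tangent_line_def osc_plane_def)
qed

lemma tangent_line_subset_osc_plane: "tangent_line t \<subseteq> osc_plane t"
  by (auto simp: tangent_line_def osc_plane_def)

lemma vertex_in_osc_planes:
  assumes "s \<in> {a..b}" "t \<in> {a..b}" "s \<noteq> t"
  shows "osc_normal s \<bullet> (vertex s t - r s) = 0" "osc_normal t \<bullet> (vertex s t - r t) = 0"
  using tangent_line_Int_osc_plane[OF assms]
  by (auto simp: osc_plane_def vertex_def)

lemma osc_normal_vertex:
  assumes "s \<in> {a..b}" "t \<in> {a..b}" "m \<in> {a..b}" "s \<noteq> t"
  shows "osc_normal m \<bullet> (vertex s t - r m) = vertex_height t s m / V s t"
proof -
  have "osc_normal m \<bullet> (vertex s t - r m) = osc_normal m \<bullet> (r t - r m) - vertex_param s t * V m t"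
    by (simp add: vertex_def inner_diff_right osc_normal_T)
  then show ?thesis
    using V_pos[OF assms(1,2,4)] osc_normal_curve[OF assms(3,2)]
    by (simp add: vertex_height_def vertex_param_def field_simps)
qed

lemma chord_normal_vertex:
  assumes "s \<in> {a..b}" "t \<in> {a..b}" "m \<in> {a..b}" "n \<in> {a..b}"
  shows "chord_normal s t \<bullet> (vertex m n - r s) =
    chord_height s t n - vertex_param m n * chord_slope s t n"
proof -
  have "vertex m n - r s = (r n - r s) - vertex_param m n *\<^sub>R T n" by (simp add: vertex_def)
  then show ?thesis
    using assms chord_normal_curve[of s t n] chord_normal_T[of s t n]
    by (simp only: inner_diff_right[of _ "r n - r s"] inner_scaleR_right)
qed

lemma chord_height_slope_ends:
  "chord_height s t s = 0" "chord_height s t t = 0" "chord_slope s t s = 0"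
  "chord_slope s t t = - minor_YV s t"
  by (simp_all add: chord_height_def chord_slope_def minor_defs algebra_simps)

abbreviation "r1 \<equiv> vertex b a"
abbreviation "r2 \<equiv> vertex a b"

lemma endpoints [simp]: "a \<le> b" "a \<noteq> b" "b \<noteq> a"
  using a_less_b by auto

lemma increment_ends_sign:
  "Y a b > 0" "V a b > 0" "Z a b > 0" "V b a > 0" "Z b a < 0" "minor_YV a b > 0"
  "vertex_param a b > 0" "vertex_param b a < 0"
  using increment_pos[of a b] increment_swap_pos[of a b] minor_YV_pos[of a b]
    vertex_param_sign[of a b] a_less_b by auto

lemma chord_normal_vertices:
  "chord_normal a b \<bullet> (r1 - r a) = 0" "chord_normal b a \<bullet> (r2 - r b) = 0"
  "chord_normal a b \<bullet> (r2 - r a) > 0" "chord_normal b a \<bullet> (r1 - r b) < 0"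
  using increment_ends_sign
  by (simp_all add: chord_normal_vertex chord_height_slope_ends minor_YV_commute[of b a]
      mult_neg_pos)

lemma chord_normal_ends: "chord_normal a b \<bullet> (r b - r a) = 0" "chord_normal b a \<bullet> (r a - r b) = 0"
  by (simp_all add: chord_normal_curve chord_height_slope_ends)

lemma osc_normal_ends: "osc_normal a \<bullet> (r b - r a) > 0" "osc_normal b \<bullet> (r a - r b) < 0"
  using increment_ends_sign by (simp_all add: osc_normal_curve)

lemma affine_hull_vertices: "affine hull {r a, r1, r2, r b} = UNIV"
proof (rule affine_hull_eq_UNIV)
  fix n c
  assume "\<And>p. p \<in> {r a, r1, r2, r b} \<Longrightarrow> n \<bullet> p = c"
  then have n: "n \<bullet> r a = c" "n \<bullet> r1 = c" "n \<bullet> r2 = c" "n \<bullet> r b = c" by auto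
  have T: "n \<bullet> T a = 0" "n \<bullet> T b = 0"
    using n increment_ends_sign by (auto simp: vertex_def inner_diff_right)
  have "n \<bullet> (r b - r a) = 0" using n by (simp add: inner_diff_right)
  then have chord: "Y a b * (n \<bullet> N a) + Z a b * (n \<bullet> e3) = 0"
    using T(1) by (simp add: curve_diff inner_add_right)
  have slope: "U a b * (n \<bullet> N a) + V a b * (n \<bullet> e3) = 0"
    using T by (simp add: T_eq[of b a] inner_add_right)
  have "minor_YV a b * (n \<bullet> e3) = Y a b * (U a b * (n \<bullet> N a) + V a b * (n \<bullet> e3))
      - U a b * (Y a b * (n \<bullet> N a) + Z a b * (n \<bullet> e3))"
    by (simp add: minor_defs algebra_simps)
  then have "n \<bullet> e3 = 0" using chord slope increment_ends_sign by simp
  moreover from this chord have "n \<bullet> N a = 0" using increment_ends_sign by simp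
  ultimately show "n = 0"
    using T(1) det det_frame[of a] by (intro eq_zero_if_orthogonal_to_basis[of "T a" "N a" e3]) auto
qed

lemma affine_hull_faces:
  "affine hull {r a, r1, r2} = osc_plane a"
  "affine hull {r1, r2, r b} = osc_plane b"
  "affine hull {r a, r2, r b} = {p. chord_normal b a \<bullet> (p - r b) = 0}"
  "affine hull {r a, r1, r b} = {p. chord_normal a b \<bullet> (p - r a) = 0}"
proof -
  show "affine hull {r a, r1, r2} = osc_plane a" unfolding osc_plane_def
    by (rule affine_hull_facet[of "r b"])
      (use affine_hull_vertices osc_normal_ends vertex_in_osc_planes in \<open>auto simp: insert_commute\<close>)
  show "affine hull {r1, r2, r b} = osc_plane b" unfolding osc_plane_def
    by (rule affine_hull_facet[of "r a"])
      (use affine_hull_vertices osc_normal_ends vertex_in_osc_planes in \<open>auto simp: insert_commute\<close>)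
  show "affine hull {r a, r2, r b} = {p. chord_normal b a \<bullet> (p - r b) = 0}"
    by (rule affine_hull_facet[of r1])
      (use affine_hull_vertices chord_normal_vertices chord_normal_ends in \<open>auto simp: insert_commute\<close>)
  show "affine hull {r a, r1, r b} = {p. chord_normal a b \<bullet> (p - r a) = 0}"
    by (rule affine_hull_facet[of r2])
      (use affine_hull_vertices chord_normal_vertices chord_normal_ends in \<open>auto simp: insert_commute\<close>)
qed

lemma in_tetrahedronI:
  assumes "osc_normal a \<bullet> (p - r a) \<ge> 0" "osc_normal b \<bullet> (p - r b) \<le> 0"
    and "chord_normal a b \<bullet> (p - r a) \<ge> 0" "chord_normal b a \<bullet> (p - r b) \<le> 0"
  shows "p \<in> tetrahedron a b"
  unfolding tetrahedron_def
proof (rule in_convex_hull_if_facets[OF _ affine_hull_vertices])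
  fix v assume "v \<in> {r a, r1, r2, r b}"
  then consider (r0) "v = r a" | (r1) "v = r1" | (r2) "v = r2" | (r3) "v = r b" by blast
  then show "\<exists>n c. (\<forall>q\<in>{r a, r1, r2, r b} - {v}. n \<bullet> (q - c) = 0) \<and> n \<bullet> (v - c) \<noteq> 0 \<and>
      0 \<le> n \<bullet> (p - c) / (n \<bullet> (v - c))"
  proof cases
    case r0
    show ?thesis
      by (rule exI[of _ "osc_normal b"], rule exI[of _ "r b"])
        (use r0 assms osc_normal_ends vertex_in_osc_planes in \<open>auto simp: divide_nonpos_neg\<close>)
  next
    case r1
    show ?thesis
      by (rule exI[of _ "chord_normal b a"], rule exI[of _ "r b"])
        (use r1 assms chord_normal_vertices chord_normal_ends in \<open>auto simp: divide_nonpos_neg\<close>)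
  next
    case r2
    show ?thesis
      by (rule exI[of _ "chord_normal a b"], rule exI[of _ "r a"])
        (use r2 assms chord_normal_vertices chord_normal_ends in auto)
  next
    case r3
    show ?thesis
      by (rule exI[of _ "osc_normal a"], rule exI[of _ "r a"])
        (use r3 assms osc_normal_ends vertex_in_osc_planes in auto)
  qed
qed simp

lemma chord_height_weak_sign:
  assumes "t \<in> {a..b}"
  shows "chord_height a b t \<ge> 0" "chord_height b a t \<le> 0"
proof -
  have "t = a \<or> t = b \<or> (a < t \<and> t < b)" using assms by auto
  then show "chord_height a b t \<ge> 0" "chord_height b a t \<le> 0"
    using chord_height_pos[of a t b] chord_height_neg[of a t b] by (auto simp: chord_height_slope_ends)
qed

lemma curve_in_tetrahedron:
  assumes "t \<in> {a..b}"
  shows "r t \<in> tetrahedron a b"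
proof (rule in_tetrahedronI)
  have "Z a t \<ge> 0" using assms increment_pos(6)[of a t] by (cases "t = a") auto
  moreover have "Z b t \<le> 0" using assms increment_swap_pos(3)[of t b] by (cases "t = b") auto
  moreover note chord_height_weak_sign[OF assms]
  ultimately show "osc_normal a \<bullet> (r t - r a) \<ge> 0" "osc_normal b \<bullet> (r t - r b) \<le> 0"
    "chord_normal a b \<bullet> (r t - r a) \<ge> 0" "chord_normal b a \<bullet> (r t - r b) \<le> 0"
    using assms by (simp_all add: osc_normal_curve chord_normal_curve)
qed

lemma initial_segment_r1_in_tetrahedron:
  assumes "a < c" "c < b"
  shows "vertex c a \<in> tetrahedron a b"
proof (rule in_tetrahedronI)
  have c: "c \<in> {a..b}" "c \<noteq> a" "b \<noteq> c" using assms by auto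
  have signs: "V c a > 0" "vertex_param c a < 0"
    using increment_swap_pos[of a c] vertex_param_sign[of a c] assms by auto
  show "osc_normal a \<bullet> (vertex c a - r a) \<ge> 0" using vertex_in_osc_planes(2)[of c a] c by simp
  have "vertex_height a c b = - vertex_height a b c" by (simp add: vertex_height_def)
  then show "osc_normal b \<bullet> (vertex c a - r b) \<le> 0"
    using osc_normal_vertex[of c a b] c vertex_height_sign(1)[of a c b] signs assms
    by (simp add: divide_nonpos_pos)
  show "chord_normal a b \<bullet> (vertex c a - r a) \<ge> 0"
    using c by (simp add: chord_normal_vertex chord_height_slope_ends)
  show "chord_normal b a \<bullet> (vertex c a - r b) \<le> 0"
    using c signs increment_ends_sign
    by (simp add: chord_normal_vertex chord_height_slope_ends minor_YV_commute[of b a] mult_neg_pos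
        less_imp_le)
qed

lemma initial_segment_r2_in_tetrahedron:
  assumes "a < c" "c < b"
  shows "vertex a c \<in> tetrahedron a b"
proof (rule in_tetrahedronI)
  have c: "c \<in> {a..b}" "a \<noteq> c" using assms by auto
  have signs: "V a c > 0" "Z a c > 0" "V b c > 0" "Z b c < 0" "minor_YV a c > 0"
    using increment_pos[of a c] increment_swap_pos[of c b] minor_YV_pos[of a c] assms by auto
  show "osc_normal a \<bullet> (vertex a c - r a) \<ge> 0" using vertex_in_osc_planes(1)[of a c] c by simp
  have "Z b c * V a c < 0" "Z a c * V b c > 0" using signs by (simp_all add: mult_neg_pos)
  then have "vertex_height c a b < 0" by (simp add: vertex_height_def)
  then show "osc_normal b \<bullet> (vertex a c - r b) \<le> 0"
    using osc_normal_vertex[of a c b] c signs by (simp add: divide_nonpos_pos)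
  have "chord_height a b c - vertex_param a c * chord_slope a b c = Z a b * minor_YV a c / V a c"
    using signs
    by (simp add: vertex_param_def chord_height_def chord_slope_def minor_YV_def field_simps)
  then show "chord_normal a b \<bullet> (vertex a c - r a) \<ge> 0"
    using c signs increment_ends_sign by (simp add: chord_normal_vertex)
  have "chord_height b a c - vertex_param a c * chord_slope b a c =
      (minor_YV a c * minor_XV a b - minor_YV a b * minor_XV a c) / V a c"
    using signs unfolding chord_height_swap[of b a] chord_slope_swap[of b a]
    by (simp add: vertex_param_def minor_XV_def[of a c] minor_YV_def[of a c] field_simps)
  then show "chord_normal b a \<bullet> (vertex a c - r b) \<le> 0"
    using c signs minor_ratio_strict_mono[of a c b] assms
    by (simp add: chord_normal_vertex divide_nonpos_pos)
qed

lemma tetrahedron_commute: "tetrahedron t s = tetrahedron s t"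
  by (simp add: tetrahedron_def insert_commute)

lemma tetrahedron_initial_segment_subset:
  assumes "a < c" "c \<le> b"
  shows "tetrahedron a c \<subseteq> tetrahedron a b"
proof (cases "c = b")
  case False
  show ?thesis unfolding tetrahedron_def[of a c]
  proof (rule hull_minimal)
    have "r a \<in> tetrahedron a b" "r c \<in> tetrahedron a b" using curve_in_tetrahedron assms by auto
    moreover have "vertex c a \<in> tetrahedron a b" "vertex a c \<in> tetrahedron a b"
      using initial_segment_r1_in_tetrahedron initial_segment_r2_in_tetrahedron assms False by auto
    ultimately show "{r a, vertex c a, vertex a c, r c} \<subseteq> tetrahedron a b" by simp
  qed (simp add: tetrahedron_def)
qed simp

lemma restrict_framed_curve:
  assumes "a \<le> s" "s < t" "t \<le> b"
  shows "framed_curve s t x y z u v w x' u' w' r origin e1 e2 e3"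
  by (intro framed_curve.intro framed_curve_axioms.intro restrict[OF assms] det curve)
    (use assms in auto)

lemma reverse_framed_curve:
  "framed_curve (- b) (- a) (\<lambda>t. - x (- t)) (\<lambda>t. y (- t)) (\<lambda>t. - z (- t)) (\<lambda>t. - u (- t))
     (\<lambda>t. v (- t)) (\<lambda>t. - w (- t)) (\<lambda>t. x' (- t)) (\<lambda>t. u' (- t)) (\<lambda>t. w' (- t))
     (\<lambda>t. r (- t)) origin (- e1) e2 (- e3)"
  by (intro framed_curve.intro framed_curve_axioms.intro reverse) (use det curve in auto)

lemma tetrahedron_final_segment_subset:
  assumes "a \<le> c" "c < b"
  shows "tetrahedron c b \<subseteq> tetrahedron a b"
proof -
  interpret rev: framed_curve "- b" "- a" "\<lambda>t. - x (- t)" "\<lambda>t. y (- t)" "\<lambda>t. - z (- t)"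
    "\<lambda>t. - u (- t)" "\<lambda>t. v (- t)" "\<lambda>t. - w (- t)" "\<lambda>t. x' (- t)" "\<lambda>t. u' (- t)" "\<lambda>t. w' (- t)"
    "\<lambda>t. r (- t)" origin "- e1" e2 "- e3"
    by (rule reverse_framed_curve)
  have "rev.T (- t) = - T t" for t by (simp add: rev.T_def T_def)
  moreover have "rev.vertex_param (- s) (- t) = - vertex_param s t" for s t
    by (simp add: rev.vertex_param_def vertex_param_def reverse_increment)
  ultimately have "rev.vertex (- s) (- t) = vertex s t" for s t
    by (simp add: rev.vertex_def vertex_def)
  then have "rev.tetrahedron (- s) (- t) = tetrahedron s t" for s t
    by (simp add: rev.tetrahedron_def tetrahedron_def)
  then show ?thesis
    using rev.tetrahedron_initial_segment_subset[of "- c"] assms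
    by (simp add: tetrahedron_commute[of b])
qed

lemma tetrahedron_subset:
  assumes "a \<le> s" "s < t" "t \<le> b"
  shows "tetrahedron s t \<subseteq> tetrahedron a b"
proof -
  interpret left: framed_curve a t x y z u v w x' u' w' r origin e1 e2 e3
    by (rule restrict_framed_curve) (use assms in auto)
  have "tetrahedron s t \<subseteq> tetrahedron a t" using left.tetrahedron_final_segment_subset assms by simp
  also have "\<dots> \<subseteq> tetrahedron a b" using tetrahedron_initial_segment_subset assms by simp
  finally show ?thesis .
qed

lemma inner_vertices_distinct: "r1 \<noteq> r2"
  using chord_normal_vertices by auto

lemma affine_hull_tangent:
  assumes "vertex_param s t \<noteq> 0"
  shows "affine hull {r t, vertex s t} = tangent_line t"
  using affine_hull_2_ray[of "- vertex_param s t" "r t" "T t"] assms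
  by (simp add: vertex_def tangent_line_def)

lemma osc_plane_sweeps_first_edge: "sweeps_line {a<..<b} osc_plane (r a) r1"
proof -
  have line: "affine hull {r a, r1} = tangent_line a"
    using increment_ends_sign by (simp add: affine_hull_tangent)
  have "strictly_monotone_on {a<..<b} (\<lambda>t. dist (r a) (vertex t a))"
  proof -
    have "strictly_monotone_on {a<..<b} (\<lambda>t. dist (r a) (r a + (- vertex_param t a) *\<^sub>R T a))"
      using vertex_param_sign(2)[of a] vertex_param_less[of a] T_nonzero
      by (intro strictly_monotone_on_dist_ray) (auto simp: less_imp_le)
    then show ?thesis by (simp add: vertex_def)
  qed
  moreover have "osc_plane t \<inter> tangent_line a = {vertex t a}" if "t \<in> {a<..<b}" for t
    using tangent_line_Int_osc_plane[of t a] that by auto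
  ultimately show ?thesis unfolding sweeps_line_def line by (intro exI[of _ "\<lambda>t. vertex t a"]) simp
qed

lemma osc_plane_sweeps_last_edge: "sweeps_line {a<..<b} osc_plane r2 (r b)"
proof -
  have line: "affine hull {r2, r b} = tangent_line b"
    using increment_ends_sign affine_hull_tangent[of a b] by (simp add: insert_commute)
  have "strictly_monotone_on {a<..<b} (\<lambda>t. dist r2 (vertex t b))"
  proof -
    have "strictly_monotone_on {a<..<b}
        (\<lambda>t. dist r2 (r2 + (vertex_param a b - vertex_param t b) *\<^sub>R T b))"
      using vertex_param_swap_less[of _ _ b] T_nonzero
      by (intro strictly_monotone_on_dist_ray) (auto simp: less_imp_le)
    then show ?thesis by (simp add: vertex_def algebra_simps)
  qed
  moreover have "osc_plane t \<inter> tangent_line b = {vertex t b}" if "t \<in> {a<..<b}" for t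
    using tangent_line_Int_osc_plane[of t b] that by auto
  ultimately show ?thesis unfolding sweeps_line_def line by (intro exI[of _ "\<lambda>t. vertex t b"]) simp
qed

lemma osc_plane_sweeps_middle_edge: "sweeps_line {a<..<b} osc_plane r1 r2"
proof (rule sweeps_lineI_barycentric[OF inner_vertices_distinct])
  let ?\<alpha> = "\<lambda>t. vertex_height a b t / V b a" and ?\<beta> = "\<lambda>t. - vertex_height b a t / V a b"
  show pos: "?\<alpha> t > 0" "?\<beta> t > 0" if "t \<in> {a<..<b}" for t
    using vertex_height_sign[of a t b] increment_ends_sign that by (auto simp: divide_neg_pos)
  show "?\<alpha> s * ?\<beta> t < ?\<alpha> t * ?\<beta> s" if "s \<in> {a<..<b}" "t \<in> {a<..<b}" "s < t" for s t
    using vertex_height_ratio[of a s t b] increment_ends_sign that by (auto simp: field_simps)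
  show "osc_plane t \<inter> affine hull {r1, r2} = {r1 + (?\<alpha> t / (?\<alpha> t + ?\<beta> t)) *\<^sub>R (r2 - r1)}"
    if "t \<in> {a<..<b}" for t
    unfolding osc_plane_def using pos[OF that] that
    by (intro plane_Int_line) (auto simp: osc_normal_vertex)
qed

lemma plane_through_middle_edge:
  "t \<in> {a<..<b} \<Longrightarrow> \<not> collinear {r1, r2, r t}"
  "sweeps_line {a<..<b} (\<lambda>t. affine hull {r1, r2, r t}) (r a) (r b)"
proof -
  have heights: "osc_normal a \<bullet> (r t - r a) / (osc_normal a \<bullet> (r b - r a)) = Z a t / Z a b"
    "osc_normal b \<bullet> (r t - r b) / (osc_normal b \<bullet> (r a - r b)) = Z b t / Z b a"
    if "t \<in> {a<..<b}" for t using that by (simp_all add: osc_normal_curve)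
  have signs: "Z a t > 0" "Z b t < 0" if "t \<in> {a<..<b}" for t
    using increment_pos(6)[of a t] increment_swap_pos(3)[of t b] that by auto
  have mono: "Z a s / Z a b * (Z b t / Z b a) < Z a t / Z a b * (Z b s / Z b a)"
    if "s \<in> {a<..<b}" "t \<in> {a<..<b}" "s < t" for s t
  proof (rule mult_strict_mono)
    show "Z a s / Z a b < Z a t / Z a b"
      using Z_strict_mono[of a s t] increment_ends_sign that by (simp add: divide_strict_right_mono)
    show "Z b t / Z b a < Z b s / Z b a"
      using Z_swap_strict_mono[of s t b] increment_ends_sign that
      by (simp add: divide_strict_right_mono_neg)
  qed (use signs that increment_ends_sign in \<open>auto simp: divide_nonpos_neg less_imp_le\<close>)
  have full: "affine hull {r1, r2, r a, r b} = UNIV"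
    using affine_hull_vertices by (simp add: insert_commute)
  note plane = plane_through_edge_sweeps_line[OF full, of "osc_normal a" "osc_normal b"
    "{a<..<b}" r]
  show "t \<in> {a<..<b} \<Longrightarrow> \<not> collinear {r1, r2, r t}"
    "sweeps_line {a<..<b} (\<lambda>t. affine hull {r1, r2, r t}) (r a) (r b)"
    by (rule plane; use heights signs mono osc_normal_ends vertex_in_osc_planes increment_ends_sign in
      \<open>simp add: divide_neg_neg\<close>)+
qed

lemma plane_through_chord:
  "t \<in> {a<..<b} \<Longrightarrow> \<not> collinear {r a, r b, r t}"
  "sweeps_line {a<..<b} (\<lambda>t. affine hull {r a, r b, r t}) r1 r2"
proof -
  have base: "chord_normal a b \<bullet> (p - r1) = chord_normal a b \<bullet> (p - r a)"
    "chord_normal b a \<bullet> (p - r2) = chord_normal b a \<bullet> (p - r b)" for p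
    using chord_normal_vertices(1,2) by (simp_all add: inner_diff_right)
  define h2 h1 where "h2 = chord_normal a b \<bullet> (r2 - r a)" and "h1 = chord_normal b a \<bullet> (r1 - r b)"
  have h_sign: "h2 > 0" "h1 < 0" using chord_normal_vertices(3,4) by (simp_all add: h2_def h1_def)
  have heights: "chord_normal a b \<bullet> (r t - r a) = chord_height a b t"
    "chord_normal b a \<bullet> (r t - r b) = chord_height b a t" if "t \<in> {a<..<b}" for t
    using that by (simp_all add: chord_normal_curve)
  have signs: "chord_height a b t > 0" "chord_height b a t < 0" if "t \<in> {a<..<b}" for t
    using chord_height_pos chord_height_neg that by auto
  have mono: "chord_height a b s / h2 * (chord_height b a t / h1)
      < chord_height a b t / h2 * (chord_height b a s / h1)"
    if "s \<in> {a<..<b}" "t \<in> {a<..<b}" "s < t" for s t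
  proof -
    have "chord_height a b t * chord_height b a s < chord_height a b s * chord_height b a t"
      using chord_height_ratio[of a s t b] that by simp
    then have "chord_height a b s * chord_height b a t / (h2 * h1)
        < chord_height a b t * chord_height b a s / (h2 * h1)"
      using h_sign by (intro divide_strict_right_mono_neg) (auto simp: mult_pos_neg)
    then show ?thesis by simp
  qed
  have full: "affine hull {r a, r b, r1, r2} = UNIV"
    using affine_hull_vertices by (simp add: insert_commute)
  note plane = plane_through_edge_sweeps_line[OF full, of "chord_normal a b" "chord_normal b a"
    "{a<..<b}" r]
  show "t \<in> {a<..<b} \<Longrightarrow> \<not> collinear {r a, r b, r t}"
    "sweeps_line {a<..<b} (\<lambda>t. affine hull {r a, r b, r t}) r1 r2"
    by (rule plane; use heights signs mono h_sign chord_normal_ends in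
      \<open>simp add: base divide_neg_neg flip: h2_def h1_def\<close>)+
qed

end

section \<open>The eight properties\<close>

lemma quasi_cubicI:
  assumes "t0 < t1" "assoc_tet r t0 t1 r0 r1 r2 r3" "\<not> coplanar {r0, r1, r2, r3}"
    and "parallel_vec (tangent_plus r t0) (r1 - r0)" "parallel_vec (tangent_minus r t1) (r3 - r2)"
    and "affine hull {r0, r1, r2} = osc_plus r t0" "affine hull {r1, r2, r3} = osc_minus r t1"
    and "r ` {t0..t1} \<subseteq> convex hull {r0, r1, r2, r3}"
    and "\<And>t. t0 < t \<Longrightarrow> t < t1 \<Longrightarrow>
      \<not> singular_param r I t \<and> curvature r t \<noteq> 0 \<and> torsion r t \<noteq> 0"
    and "\<And>a b. t0 \<le> a \<Longrightarrow> a < b \<Longrightarrow> b \<le> t1 \<Longrightarrow> \<exists>s0 s1 s2 s3. assoc_tet r a b s0 s1 s2 s3 \<and>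
      convex hull {s0, s1, s2, s3} \<subseteq> convex hull {r0, r1, r2, r3}"
    and osc: "sweeps_line {t0<..<t1} (osc r) r0 r1" "sweeps_line {t0<..<t1} (osc r) r1 r2"
      "sweeps_line {t0<..<t1} (osc r) r2 r3"
    and "\<And>t. t \<in> {t0<..<t1} \<Longrightarrow> \<not> collinear {r1, r2, r t}"
      "\<And>t. t \<in> {t0<..<t1} \<Longrightarrow> \<not> collinear {r0, r3, r t}"
    and edge: "sweeps_line {t0<..<t1} (\<lambda>t. affine hull {r1, r2, r t}) r0 r3"
      "sweeps_line {t0<..<t1} (\<lambda>t. affine hull {r0, r3, r t}) r1 r2"
    and "\<exists>p. parallel_points r t0 t1 (affine hull {r0, r2, r3}) = {p} \<and>
      farthest_points r t0 t1 (affine hull {r0, r2, r3}) = {p}"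
    and "\<exists>p. parallel_points r t0 t1 (affine hull {r0, r1, r3}) = {p} \<and>
      farthest_points r t0 t1 (affine hull {r0, r1, r3}) = {p}"
  shows "quasi_cubic r I t0 t1"
  unfolding quasi_cubic_def
proof (rule conjI[OF assms(1)], rule exI[of _ r0], rule exI[of _ r1], rule exI[of _ r2],
    rule exI[of _ r3], intro conjI)
  obtain p01 p12 p23 where "\<forall>t\<in>{t0<..<t1}. osc r t \<inter> affine hull {r0, r1} = {p01 t}"
    "\<forall>t\<in>{t0<..<t1}. osc r t \<inter> affine hull {r1, r2} = {p12 t}"
    "\<forall>t\<in>{t0<..<t1}. osc r t \<inter> affine hull {r2, r3} = {p23 t}"
    "strictly_monotone_on {t0<..<t1} (\<lambda>t. dist r0 (p01 t))"
    "strictly_monotone_on {t0<..<t1} (\<lambda>t. dist r1 (p12 t))"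
    "strictly_monotone_on {t0<..<t1} (\<lambda>t. dist r2 (p23 t))"
    using osc unfolding sweeps_line_def by blast
  then show "\<exists>p01 p12 p23.
      (\<forall>t. t0 < t \<and> t < t1 \<longrightarrow>
         osc r t \<inter> affine hull {r0, r1} = {p01 t} \<and>
         osc r t \<inter> affine hull {r1, r2} = {p12 t} \<and>
         osc r t \<inter> affine hull {r2, r3} = {p23 t}) \<and>
      strictly_monotone_on {t0<..<t1} (\<lambda>t. dist r0 (p01 t)) \<and>
      strictly_monotone_on {t0<..<t1} (\<lambda>t. dist r1 (p12 t)) \<and>
      strictly_monotone_on {t0<..<t1} (\<lambda>t. dist r2 (p23 t))"
    by (intro exI[of _ p01] exI[of _ p12] exI[of _ p23]) simp
  obtain p03 q12 where "\<forall>t\<in>{t0<..<t1}. affine hull {r1, r2, r t} \<inter> affine hull {r0, r3} = {p03 t}"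
    "\<forall>t\<in>{t0<..<t1}. affine hull {r0, r3, r t} \<inter> affine hull {r1, r2} = {q12 t}"
    "strictly_monotone_on {t0<..<t1} (\<lambda>t. dist r0 (p03 t))"
    "strictly_monotone_on {t0<..<t1} (\<lambda>t. dist r1 (q12 t))"
    using edge unfolding sweeps_line_def by blast
  then show "\<exists>p03 q12.
      (\<forall>t. t0 < t \<and> t < t1 \<longrightarrow>
         \<not> collinear {r1, r2, r t} \<and> \<not> collinear {r0, r3, r t} \<and>
         affine hull {r1, r2, r t} \<inter> affine hull {r0, r3} = {p03 t} \<and>
         affine hull {r0, r3, r t} \<inter> affine hull {r1, r2} = {q12 t}) \<and>
      strictly_monotone_on {t0<..<t1} (\<lambda>t. dist r0 (p03 t)) \<and>
      strictly_monotone_on {t0<..<t1} (\<lambda>t. dist r1 (q12 t))"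
    using assms by (intro exI[of _ p03] exI[of _ q12]) simp
qed (use assms in auto)

lemma Lim_at_right_eq:
  fixes h k :: "real \<Rightarrow> 'a::t2_space"
  assumes "continuous_on {s..b} h" "s < b" "\<And>t. s < t \<Longrightarrow> t < b \<Longrightarrow> k t = h t"
  shows "Lim (at_right s) k = h s"
proof (rule tendsto_Lim)
  have "eventually (\<lambda>t. h t = k t) (at_right s)"
    using assms(2,3) by (auto simp: eventually_at_right[OF assms(2)])
  then show "(k \<longlongrightarrow> h s) (at_right s)"
    by (rule Lim_transform_eventually[OF continuous_on_Icc_at_rightD[OF assms(1,2)]])
qed simp

lemma Lim_at_left_eq:
  fixes h k :: "real \<Rightarrow> 'a::t2_space"
  assumes "continuous_on {a..s} h" "a < s" "\<And>t. a < t \<Longrightarrow> t < s \<Longrightarrow> k t = h t"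
  shows "Lim (at_left s) k = h s"
proof (rule tendsto_Lim)
  have "eventually (\<lambda>t. h t = k t) (at_left s)"
    using assms(2,3) by (auto simp: eventually_at_left[OF assms(2)])
  then show "(k \<longlongrightarrow> h s) (at_left s)"
    by (rule Lim_transform_eventually[OF continuous_on_Icc_at_leftD[OF assms(1,2)]])
qed simp

lemma has_vector_derivative_transform_interval:
  fixes h k :: "real \<Rightarrow> 'a::real_normed_vector"
  assumes "(k has_vector_derivative k') (at t)" "a < t" "t < b"
    and "\<And>s. a < s \<Longrightarrow> s < b \<Longrightarrow> h s = k s"
  shows "(h has_vector_derivative k') (at t)"
  by (rule has_vector_derivative_transform_within_open[OF assms(1), of "{a<..<b}"])
    (use assms in auto)

locale smooth_framed_curve = framed_curve a b x y z u v w x' u' w' r origin e1 e2 e3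
  for a b x y z u v w x' u' w' r origin e1 e2 e3 +
  fixes x'' x''' u'' :: "real \<Rightarrow> real"
  assumes higher_deriv: "\<And>t. a < t \<Longrightarrow> t < b \<Longrightarrow> (x' has_real_derivative x'' t) (at t)"
      "\<And>t. a < t \<Longrightarrow> t < b \<Longrightarrow> (x'' has_real_derivative x''' t) (at t)"
      "\<And>t. a < t \<Longrightarrow> t < b \<Longrightarrow> (u' has_real_derivative u'' t) (at t)"
begin

lemma deriv_curve:
  assumes "a < t" "t < b"
  shows "(r has_vector_derivative x' t *\<^sub>R T t) (at t)"
proof (rule has_vector_derivative_transform_interval[OF _ assms])
  show "((\<lambda>s. origin + x s *\<^sub>R e1 + y s *\<^sub>R e2 + z s *\<^sub>R e3) has_vector_derivative x' t *\<^sub>R T t) (at t)"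
    by (auto intro!: derivative_eq_intros deriv assms simp: T_def algebra_simps)
qed (simp add: curve)

lemma deriv_T: "a < t \<Longrightarrow> t < b \<Longrightarrow> (T has_vector_derivative u' t *\<^sub>R N t) (at t)"
  unfolding T_def[abs_def] N_def by (auto intro!: derivative_eq_intros deriv simp: algebra_simps)

lemma deriv_N: "a < t \<Longrightarrow> t < b \<Longrightarrow> (N has_vector_derivative w' t *\<^sub>R e3) (at t)"
  unfolding N_def[abs_def] by (auto intro!: derivative_eq_intros deriv)

lemma d1_eq: "a < t \<Longrightarrow> t < b \<Longrightarrow> d1 r t = x' t *\<^sub>R T t"
  unfolding d1_def by (rule vector_derivative_at[OF deriv_curve])

lemma d2_eq:
  assumes "a < t" "t < b"
  shows "d2 r t = x'' t *\<^sub>R T t + (x' t * u' t) *\<^sub>R N t"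
  unfolding d2_def
proof (rule vector_derivative_at, rule has_vector_derivative_transform_interval[OF _ assms])
  show "((\<lambda>t. x' t *\<^sub>R T t) has_vector_derivative x'' t *\<^sub>R T t + (x' t * u' t) *\<^sub>R N t) (at t)"
    by (auto intro!: derivative_eq_intros higher_deriv deriv_T assms)
qed (simp add: d1_eq)

lemma d3_eq:
  assumes "a < t" "t < b"
  shows "d3 r t =
    x''' t *\<^sub>R T t + (x'' t * u' t + x'' t * u' t + x' t * u'' t) *\<^sub>R N t + (x' t * u' t * w' t) *\<^sub>R e3"
  unfolding d3_def
proof (rule vector_derivative_at, rule has_vector_derivative_transform_interval[OF _ assms])
  show "((\<lambda>t. x'' t *\<^sub>R T t + (x' t * u' t) *\<^sub>R N t) has_vector_derivative
      x''' t *\<^sub>R T t + (x'' t * u' t + x'' t * u' t + x' t * u'' t) *\<^sub>R N t +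
      (x' t * u' t * w' t) *\<^sub>R e3) (at t)"
    by (auto intro!: derivative_eq_intros higher_deriv deriv_T deriv_N assms
        simp: vec_eq_iff algebra_simps)
qed (simp add: d2_eq)

lemma cross_d1_d2:
  assumes "a < t" "t < b"
  shows "cross3 (d1 r t) (d2 r t) = ((x' t)\<^sup>2 * u' t * (cross3 e1 e2 \<bullet> e3)) *\<^sub>R osc_normal t"
  using det by (simp add: d1_eq[OF assms] d2_eq[OF assms] cross_add_right cross_mult_left
      cross_mult_right osc_normal_def power2_eq_square)

lemma d1_curvature_torsion_nonzero:
  assumes "a < t" "t < b"
  shows "d1 r t \<noteq> 0" "curvature r t \<noteq> 0" "torsion r t \<noteq> 0"
proof -
  note pos = deriv_pos[OF assms]
  show d1: "d1 r t \<noteq> 0" using pos T_nonzero by (simp add: d1_eq[OF assms])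
  have cross: "cross3 (d1 r t) (d2 r t) \<noteq> 0"
    using pos det osc_normal_nonzero by (simp add: cross_d1_d2[OF assms])
  then show "curvature r t \<noteq> 0" using d1 by (simp add: curvature_def)
  have "cross3 (d1 r t) (d2 r t) \<bullet> d3 r t =
      (x' t)\<^sup>2 * u' t * (cross3 e1 e2 \<bullet> e3) * (x' t * u' t * w' t)"
    by (simp add: cross_d1_d2[OF assms] d3_eq[OF assms] inner_add_right)
  then show "torsion r t \<noteq> 0" using cross pos det by (simp add: torsion_def)
qed

lemma unit_tangent_eq: "a < t \<Longrightarrow> t < b \<Longrightarrow> unit_tangent r t = (1 / norm (T t)) *\<^sub>R T t"
  using deriv_pos(1)[of t] by (simp add: unit_tangent_def d1_eq)

lemma unit_binormal_eq: "a < t \<Longrightarrow> t < b \<Longrightarrow>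
    unit_binormal r t = (sgn (cross3 e1 e2 \<bullet> e3) / norm (osc_normal t)) *\<^sub>R osc_normal t"
  using deriv_pos[of t] det by (simp add: unit_binormal_def cross_d1_d2 abs_mult real_sgn_eq)

lemma continuous_on_unit_tangent: "continuous_on {a..b} (\<lambda>t. (1 / norm (T t)) *\<^sub>R T t)"
proof -
  have "continuous_on {a..b} T" unfolding T_def[abs_def] by (intro continuous_intros cont)
  then show ?thesis by (intro continuous_intros) (auto simp: T_nonzero)
qed

lemma continuous_on_unit_binormal:
  "continuous_on {a..b} (\<lambda>t. (sgn (cross3 e1 e2 \<bullet> e3) / norm (osc_normal t)) *\<^sub>R osc_normal t)"
proof -
  have "continuous_on {a..b} osc_normal"
    unfolding osc_normal_def[abs_def] T_def N_def by (intro continuous_intros cont continuous_on_cross)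
  then show ?thesis by (intro continuous_intros) (auto simp: osc_normal_nonzero)
qed

lemma tangent_plus_eq:
  assumes "a \<le> s" "s < b"
  shows "tangent_plus r s = (1 / norm (T s)) *\<^sub>R T s"
  unfolding tangent_plus_def
  by (rule Lim_at_right_eq[OF continuous_on_subset[OF continuous_on_unit_tangent] assms(2)])
    (use assms in \<open>auto simp: unit_tangent_eq\<close>)

lemma tangent_minus_eq:
  assumes "a < s" "s \<le> b"
  shows "tangent_minus r s = (1 / norm (T s)) *\<^sub>R T s"
  unfolding tangent_minus_def
  by (rule Lim_at_left_eq[OF continuous_on_subset[OF continuous_on_unit_tangent] assms(1)])
    (use assms in \<open>auto simp: unit_tangent_eq\<close>)

lemma binormal_plus_eq:
  assumes "a \<le> s" "s < b"
  shows "binormal_plus r s = (sgn (cross3 e1 e2 \<bullet> e3) / norm (osc_normal s)) *\<^sub>R osc_normal s"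
  unfolding binormal_plus_def
  by (rule Lim_at_right_eq[OF continuous_on_subset[OF continuous_on_unit_binormal] assms(2)])
    (use assms in \<open>auto simp: unit_binormal_eq\<close>)

lemma binormal_minus_eq:
  assumes "a < s" "s \<le> b"
  shows "binormal_minus r s = (sgn (cross3 e1 e2 \<bullet> e3) / norm (osc_normal s)) *\<^sub>R osc_normal s"
  unfolding binormal_minus_def
  by (rule Lim_at_left_eq[OF continuous_on_subset[OF continuous_on_unit_binormal] assms(1)])
    (use assms in \<open>auto simp: unit_binormal_eq\<close>)

lemma tangent_line_eq: "tangent_line s = {r s + c *\<^sub>R (1 / norm (T s)) *\<^sub>R T s | c. True}"
  using affine_hull_2_ray[of "1 / norm (T s)" "r s" "T s"]
    affine_hull_2_ray[of 1 "r s" "(1 / norm (T s)) *\<^sub>R T s"]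
    T_nonzero[of s] by (simp add: tangent_line_def)

lemma tline_eq:
  "a \<le> s \<Longrightarrow> s < b \<Longrightarrow> tline_plus r s = tangent_line s"
  "a < s \<Longrightarrow> s \<le> b \<Longrightarrow> tline_minus r s = tangent_line s"
  by (simp_all only: tline_plus_def tline_minus_def tangent_plus_eq tangent_minus_eq tangent_line_eq)

lemma osc_eq:
  "a < s \<Longrightarrow> s < b \<Longrightarrow> osc r s = osc_plane s"
  "a \<le> s \<Longrightarrow> s < b \<Longrightarrow> osc_plus r s = osc_plane s"
  "a < s \<Longrightarrow> s \<le> b \<Longrightarrow> osc_minus r s = osc_plane s"
  using osc_normal_nonzero[of s] det
  by (simp_all add: osc_def osc_plus_def osc_minus_def osc_plane_def unit_binormal_eq binormal_plus_eq
      binormal_minus_eq inner_commute sgn_zero_iff)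

lemma assoc_tet_vertices:
  assumes "a \<le> s" "s < t" "t \<le> b"
  shows "assoc_tet r s t (r s) (vertex t s) (vertex s t) (r t)"
proof -
  interpret segment: framed_curve s t x y z u v w x' u' w' r origin e1 e2 e3
    by (rule restrict_framed_curve[OF assms])
  have "tangent_line s \<inter> (osc_plane s \<inter> osc_plane t) = {vertex t s}"
    "tangent_line t \<inter> (osc_plane s \<inter> osc_plane t) = {vertex s t}"
    using tangent_line_Int_osc_plane[of t s] tangent_line_Int_osc_plane[of s t]
      tangent_line_subset_osc_plane[of s] tangent_line_subset_osc_plane[of t] assms by auto
  then show ?thesis
    using assms segment.inner_vertices_distinct by (simp add: assoc_tet_def tline_eq osc_eq)
qed

lemma parallel_tangents:
  "parallel_vec (tangent_plus r a) (r1 - r a)" "parallel_vec (tangent_minus r b) (r b - r2)"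
  using increment_ends_sign a_less_b T_nonzero
  by (simp_all add: parallel_vec_def vertex_def tangent_plus_eq tangent_minus_eq cross_mult_left
      cross_mult_right)

lemma continuous_on_curve: "continuous_on {a..b} r"
proof -
  have "continuous_on {a..b} (\<lambda>t. origin + x t *\<^sub>R e1 + y t *\<^sub>R e2 + z t *\<^sub>R e3)"
    by (intro continuous_intros cont)
  then show ?thesis by (rule continuous_on_eq) (simp add: curve)
qed

lemma parallel_point_013:
  "\<exists>p. parallel_points r a b (affine hull {r a, r1, r b}) = {p} \<and>
    farthest_points r a b (affine hull {r a, r1, r b}) = {p}"
  unfolding affine_hull_faces
proof (rule parallel_point_eq_farthest_point[OF a_less_b continuous_on_curve _ _ deriv_curve])
  show "chord_normal a b \<noteq> 0" using chord_normal_vertices(3) by auto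
  show "chord_normal a b \<bullet> (r b - r a) = 0" by (rule chord_normal_ends)
  show "chord_normal a b \<bullet> (r t - r a) \<ge> 0" if "a \<le> t" "t \<le> b" for t
    using chord_height_weak_sign[of t] that by (simp add: chord_normal_curve)
  show "chord_normal a b \<bullet> (x' t *\<^sub>R T t) < 0"
    if "a < s" "s < t" "t < b" "chord_normal a b \<bullet> (x' s *\<^sub>R T s) \<le> 0" for s t
    using chord_slope_neg[of a s t b] deriv_pos(1)[of s] deriv_pos(1)[of t] that
    by (auto simp: chord_normal_T mult_pos_neg mult_le_0_iff)
qed

lemma parallel_point_023:
  "\<exists>p. parallel_points r a b (affine hull {r a, r2, r b}) = {p} \<and>
    farthest_points r a b (affine hull {r a, r2, r b}) = {p}"
proof -
  have plane: "affine hull {r a, r2, r b} = {p. - chord_normal b a \<bullet> (p - r a) = 0}"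
    unfolding affine_hull_faces using chord_normal_ends(2) by (auto simp: inner_diff_right)
  show ?thesis unfolding plane
  proof (rule parallel_point_eq_farthest_point[OF a_less_b continuous_on_curve _ _ deriv_curve])
    show "- chord_normal b a \<noteq> 0" using chord_normal_vertices(4) by auto
    show "- chord_normal b a \<bullet> (r b - r a) = 0"
      using chord_normal_ends(2) by (simp add: inner_diff_right)
    show "- chord_normal b a \<bullet> (r t - r a) \<ge> 0" if "a \<le> t" "t \<le> b" for t
    proof -
      have "- chord_normal b a \<bullet> (r t - r a) = - (chord_normal b a \<bullet> (r t - r b))"
        using chord_normal_ends(2) by (simp add: inner_diff_right)
      then show ?thesis using chord_height_weak_sign[of t] that by (simp add: chord_normal_curve)
    qed
    show "- chord_normal b a \<bullet> (x' t *\<^sub>R T t) < 0"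
      if "a < s" "s < t" "t < b" "- chord_normal b a \<bullet> (x' s *\<^sub>R T s) \<le> 0" for s t
      using chord_slope_pos[of a s t b] deriv_pos(1)[of s] deriv_pos(1)[of t] that
      by (auto simp: chord_normal_T zero_le_mult_iff)
  qed
qed

lemma osc_sweeps_line_iff: "sweeps_line {a<..<b} (osc r) p q \<longleftrightarrow> sweeps_line {a<..<b} osc_plane p q"
  by (simp add: sweeps_line_def osc_eq)

theorem quasi_cubic_if_injective:
  assumes "\<And>s t. a < t \<Longrightarrow> t < b \<Longrightarrow> s \<in> I \<Longrightarrow> s \<noteq> t \<Longrightarrow> r s \<noteq> r t"
  shows "quasi_cubic r I a b"
proof (rule quasi_cubicI[OF a_less_b])
  show "assoc_tet r a b (r a) r1 r2 (r b)" using assoc_tet_vertices a_less_b by simp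
  show "affine hull {r a, r1, r2} = osc_plus r a" "affine hull {r1, r2, r b} = osc_minus r b"
    using a_less_b by (simp_all add: affine_hull_faces osc_eq)
  show "r ` {a..b} \<subseteq> convex hull {r a, r1, r2, r b}"
    using curve_in_tetrahedron by (auto simp: tetrahedron_def)
  show "\<not> singular_param r I t \<and> curvature r t \<noteq> 0 \<and> torsion r t \<noteq> 0" if "a < t" "t < b" for t
    using d1_curvature_torsion_nonzero[OF that] assms[OF that] unfolding singular_param_def by blast
  show "\<exists>s0 s1 s2 s3. assoc_tet r s t s0 s1 s2 s3 \<and>
      convex hull {s0, s1, s2, s3} \<subseteq> convex hull {r a, r1, r2, r b}"
    if "a \<le> s" "s < t" "t \<le> b" for s t
    using assoc_tet_vertices[OF that] tetrahedron_subset[OF that] unfolding tetrahedron_def by blast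
qed (use not_coplanar_if_affine_hull_UNIV[OF affine_hull_vertices] parallel_tangents
    osc_plane_sweeps_first_edge osc_plane_sweeps_middle_edge osc_plane_sweeps_last_edge
    plane_through_middle_edge plane_through_chord parallel_point_023 parallel_point_013
    in \<open>auto simp: osc_sweeps_line_iff\<close>)

end

section \<open>Germs of rational curves\<close>

definition pos_germ :: "real \<Rightarrow> nat \<Rightarrow> (real \<Rightarrow> real) \<Rightarrow> bool" where
  "pos_germ c k h \<longleftrightarrow>
     (\<exists>P Q. poly P c / poly Q c > 0 \<and> h = (\<lambda>t. (t - c) ^ k * (poly P t / poly Q t)))"

lemma eventually_ratio_pos:
  fixes P Q :: "real poly"
  assumes "poly P c / poly Q c > 0"
  shows "\<forall>\<^sub>F t in nhds c. poly P t / poly Q t > 0"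
proof -
  have "isCont (\<lambda>t. poly P t / poly Q t) c" using assms by (intro continuous_intros) auto
  then have "((\<lambda>t. poly P t / poly Q t) \<longlongrightarrow> poly P c / poly Q c) (nhds c)"
    by (simp add: continuous_at tendsto_nhds_iff)
  then show ?thesis using assms by (rule order_tendstoD)
qed

lemma DERIV_rational:
  fixes P Q :: "real poly"
  assumes "poly Q t \<noteq> 0"
  shows "((\<lambda>t. poly P t / poly Q t) has_real_derivative
    poly (pderiv P * Q - P * pderiv Q) t / poly (Q * Q) t) (at t)"
  using assms by (auto intro!: derivative_eq_intros)

lemma eventually_DERIV_rational:
  fixes P Q :: "real poly"
  assumes "poly Q c \<noteq> 0"
  obtains P' Q' where "poly Q' c \<noteq> 0" "\<forall>\<^sub>F t in nhds c.
    ((\<lambda>t. poly P t / poly Q t) has_real_derivative poly P' t / poly Q' t) (at t)"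
proof
  show "poly (Q * Q) c \<noteq> 0" using assms by simp
  have "\<forall>\<^sub>F t in nhds c. poly Q t / poly Q t > 0" by (rule eventually_ratio_pos) (use assms in simp)
  then have "\<forall>\<^sub>F t in nhds c. poly Q t \<noteq> 0" by eventually_elim auto
  then show "\<forall>\<^sub>F t in nhds c. ((\<lambda>t. poly P t / poly Q t) has_real_derivative
      poly (pderiv P * Q - P * pderiv Q) t / poly (Q * Q) t) (at t)"
    by eventually_elim (rule DERIV_rational)
qed

lemma pos_germ_deriv:
  assumes "pos_germ c k h" "k > 0"
  obtains h' where "pos_germ c (k - 1) h'" "\<forall>\<^sub>F t in nhds c. (h has_real_derivative h' t) (at t)"
proof -
  obtain P Q where PQ: "poly P c / poly Q c > 0"
    and h: "h = (\<lambda>t. (t - c) ^ k * (poly P t / poly Q t))"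
    using assms unfolding pos_germ_def by auto
  define P' where "P' = smult (real k) (P * Q) + [:- c, 1:] * (pderiv P * Q - P * pderiv Q)"
  define h' where "h' = (\<lambda>t. (t - c) ^ (k - 1) * (poly P' t / poly (Q * Q) t))"
  have "poly P' c / poly (Q * Q) c = real k * (poly P c / poly Q c)" using PQ by (auto simp: P'_def)
  then have "pos_germ c (k - 1) h'"
    unfolding pos_germ_def h'_def using PQ assms(2) by (metis mult_pos_pos of_nat_0_less_iff)
  moreover have "(h has_real_derivative h' t) (at t)" if "poly Q t \<noteq> 0" for t
  proof -
    have "(h has_real_derivative real k * (t - c) ^ (k - 1) * (poly P t / poly Q t) +
        poly (pderiv P * Q - P * pderiv Q) t / poly (Q * Q) t * (t - c) ^ k) (at t)"
      unfolding h by (rule DERIV_mult) (auto intro!: derivative_eq_intros DERIV_rational that)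
    moreover have "(t - c) ^ k = (t - c) ^ (k - 1) * (t - c)" using assms(2) by (simp flip: power_Suc2)
    ultimately show ?thesis using that by (simp add: h'_def P'_def field_simps)
  qed
  then have "\<forall>\<^sub>F t in nhds c. (h has_real_derivative h' t) (at t)"
    using eventually_ratio_pos[OF PQ] by (rule eventually_mono[rotated]) auto
  ultimately show ?thesis using that by blast
qed

lemma pos_germ_twice_deriv:
  assumes "pos_germ c k h"
  obtains h' h'' where "\<forall>\<^sub>F t in nhds c. (h has_real_derivative h' t) (at t)"
    "\<forall>\<^sub>F t in nhds c. (h' has_real_derivative h'' t) (at t)"
proof -
  obtain P Q where "poly P c / poly Q c > 0" "h = (\<lambda>t. (t - c) ^ k * (poly P t / poly Q t))"
    using assms unfolding pos_germ_def by auto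
  then have h: "h = (\<lambda>t. poly ([:- c, 1:] ^ k * P) t / poly Q t)" and Q: "poly Q c \<noteq> 0" by auto
  obtain P' Q' where Q': "poly Q' c \<noteq> 0"
    and h': "\<forall>\<^sub>F t in nhds c. (h has_real_derivative poly P' t / poly Q' t) (at t)"
    unfolding h by (rule eventually_DERIV_rational[OF Q])
  obtain P'' Q'' where "\<forall>\<^sub>F t in nhds c.
      ((\<lambda>t. poly P' t / poly Q' t) has_real_derivative poly P'' t / poly Q'' t) (at t)"
    by (rule eventually_DERIV_rational[OF Q'])
  with h' show ?thesis by (rule that)
qed

lemma pos_germ_quotient:
  assumes "pos_germ c k h" "pos_germ c j g" "j \<le> k"
  obtains u where "pos_germ c (k - j) u" "\<forall>\<^sub>F t in nhds c. h t = u t * g t"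
proof -
  obtain P Q where PQ: "poly P c / poly Q c > 0"
    and h: "h = (\<lambda>t. (t - c) ^ k * (poly P t / poly Q t))"
    using assms(1) unfolding pos_germ_def by auto
  obtain P' Q' where PQ': "poly P' c / poly Q' c > 0"
    and g: "g = (\<lambda>t. (t - c) ^ j * (poly P' t / poly Q' t))"
    using assms(2) unfolding pos_germ_def by auto
  define u where "u = (\<lambda>t. (t - c) ^ (k - j) * (poly (P * Q') t / poly (Q * P') t))"
  have "poly (P * Q') c / poly (Q * P') c = poly P c / poly Q c / (poly P' c / poly Q' c)" by simp
  then have "pos_germ c (k - j) u"
    unfolding pos_germ_def u_def using PQ PQ' by (metis divide_pos_pos)
  moreover have "\<forall>\<^sub>F t in nhds c. h t = u t * g t"
    using eventually_ratio_pos[OF PQ']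
  proof eventually_elim
    case (elim t)
    have "(t - c) ^ k = (t - c) ^ (k - j) * (t - c) ^ j" using assms(3) by (simp flip: power_add)
    then show ?case using elim by (auto simp: h g u_def)
  qed
  ultimately show ?thesis using that by blast
qed

lemma pos_germ_slope:
  assumes "pos_germ c k h" "pos_germ c j g" "j < k"
  shows "\<exists>u. pos_germ c (k - Suc j) u \<and> (\<forall>\<^sub>F t in nhds c. (h has_real_derivative u t * g t) (at t))"
proof -
  have "k > 0" "j \<le> k - 1" using assms(3) by auto
  obtain h' where h': "pos_germ c (k - 1) h'" "\<forall>\<^sub>F t in nhds c. (h has_real_derivative h' t) (at t)"
    using pos_germ_deriv[OF assms(1) \<open>k > 0\<close>] .
  obtain u where u: "pos_germ c (k - 1 - j) u"
      "\<forall>\<^sub>F t in nhds c. h' t = u t * g t"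
    using pos_germ_quotient[OF h'(1) assms(2) \<open>j \<le> k - 1\<close>] .
  have "\<forall>\<^sub>F t in nhds c. (h has_real_derivative u t * g t) (at t)"
    using h'(2) u(2) by eventually_elim simp
  then show ?thesis using u(1) by auto
qed

lemma pos_germ_eventually_pos:
  assumes "pos_germ c k h"
  shows "\<forall>\<^sub>F t in nhds c. c < t \<longrightarrow> h t > 0"
proof -
  obtain P Q where PQ: "poly P c / poly Q c > 0"
    and h: "h = (\<lambda>t. (t - c) ^ k * (poly P t / poly Q t))"
    using assms unfolding pos_germ_def by auto
  show ?thesis using eventually_ratio_pos[OF PQ]
    by eventually_elim (simp add: h del: times_divide_eq_right)
qed

lemma pos_germ_chain:
  assumes x: "pos_germ c k1 x" and y: "pos_germ c k2 y" and z: "pos_germ c k3 z"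
    and k: "0 < k1" "k1 < k2" "k2 < k3"
  obtains u v w x' u' w' where
    "pos_germ c (k1 - 1) x'" "pos_germ c (k2 - k1 - 1) u'" "pos_germ c (k3 - k2 - 1) w'"
    "\<forall>\<^sub>F t in nhds c. (x has_real_derivative x' t) (at t)"
    "\<forall>\<^sub>F t in nhds c. (y has_real_derivative u t * x' t) (at t)"
    "\<forall>\<^sub>F t in nhds c. (z has_real_derivative v t * x' t) (at t)"
    "\<forall>\<^sub>F t in nhds c. (u has_real_derivative u' t) (at t)"
    "\<forall>\<^sub>F t in nhds c. (v has_real_derivative w t * u' t) (at t)"
    "\<forall>\<^sub>F t in nhds c. (w has_real_derivative w' t) (at t)"
proof -
  obtain x' where x': "pos_germ c (k1 - 1) x'"
      "\<forall>\<^sub>F t in nhds c. (x has_real_derivative x' t) (at t)"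
    using pos_germ_deriv[OF x k(1)] .
  have orders: "k2 - Suc (k1 - 1) = k2 - k1" "k3 - Suc (k1 - 1) = k3 - k1"
    "k3 - k1 - Suc (k2 - k1 - 1) = k3 - k2" using k by auto
  have less: "k1 - 1 < k2" "k1 - 1 < k3" "k2 - k1 - 1 < k3 - k1" using k by auto
  obtain u where u: "pos_germ c (k2 - k1) u"
      "\<forall>\<^sub>F t in nhds c. (y has_real_derivative u t * x' t) (at t)"
    using pos_germ_slope[OF y x'(1) less(1)] unfolding orders by auto
  obtain v where v: "pos_germ c (k3 - k1) v"
      "\<forall>\<^sub>F t in nhds c. (z has_real_derivative v t * x' t) (at t)"
    using pos_germ_slope[OF z x'(1) less(2)] unfolding orders by auto
  obtain u' where u': "pos_germ c (k2 - k1 - 1) u'"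
      "\<forall>\<^sub>F t in nhds c. (u has_real_derivative u' t) (at t)"
    using pos_germ_deriv[OF u(1)] k by (metis zero_less_diff)
  obtain w where w: "pos_germ c (k3 - k2) w"
      "\<forall>\<^sub>F t in nhds c. (v has_real_derivative w t * u' t) (at t)"
    using pos_germ_slope[OF v(1) u'(1) less(3)] unfolding orders by auto
  obtain w' where w': "pos_germ c (k3 - k2 - 1) w'"
      "\<forall>\<^sub>F t in nhds c. (w has_real_derivative w' t) (at t)"
    using pos_germ_deriv[OF w(1)] k by (metis zero_less_diff)
  show ?thesis using that x' u v u' w w' by blast
qed

theorem quasi_cubic_if_pos_germs:
  assumes x: "pos_germ c k1 x" and y: "pos_germ c k2 y" and z: "pos_germ c k3 z"
    and k: "0 < k1" "k1 < k2" "k2 < k3"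
    and det: "cross3 e1 e2 \<bullet> e3 \<noteq> 0"
    and curve: "\<And>t. t \<in> I \<Longrightarrow> r t = origin + x t *\<^sub>R e1 + y t *\<^sub>R e2 + z t *\<^sub>R e3"
  obtains \<delta> where "\<delta> > 0"
    "\<And>b. c < b \<Longrightarrow> b < c + \<delta> \<Longrightarrow> {c..b} \<subseteq> I \<Longrightarrow>
      (\<And>s t. c < t \<Longrightarrow> t < b \<Longrightarrow> s \<in> I \<Longrightarrow> s \<noteq> t \<Longrightarrow> r s \<noteq> r t) \<Longrightarrow> quasi_cubic r I c b"
proof -
  obtain u v w x' u' w' where pos: "pos_germ c (k1 - 1) x'" "pos_germ c (k2 - k1 - 1) u'"
      "pos_germ c (k3 - k2 - 1) w'"
    and deriv: "\<forall>\<^sub>F t in nhds c. (x has_real_derivative x' t) (at t)"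
      "\<forall>\<^sub>F t in nhds c. (y has_real_derivative u t * x' t) (at t)"
      "\<forall>\<^sub>F t in nhds c. (z has_real_derivative v t * x' t) (at t)"
      "\<forall>\<^sub>F t in nhds c. (u has_real_derivative u' t) (at t)"
      "\<forall>\<^sub>F t in nhds c. (v has_real_derivative w t * u' t) (at t)"
      "\<forall>\<^sub>F t in nhds c. (w has_real_derivative w' t) (at t)"
    using pos_germ_chain[OF x y z k] .
  obtain x'' x''' where x'': "\<forall>\<^sub>F t in nhds c. (x' has_real_derivative x'' t) (at t)"
      "\<forall>\<^sub>F t in nhds c. (x'' has_real_derivative x''' t) (at t)"
    using pos_germ_twice_deriv[OF pos(1)] .
  obtain u'' where u'': "\<forall>\<^sub>F t in nhds c. (u' has_real_derivative u'' t) (at t)"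
    using pos_germ_twice_deriv[OF pos(2)] by metis
  let ?regular = "\<lambda>t. (x has_real_derivative x' t) (at t) \<and> (y has_real_derivative u t * x' t) (at t) \<and>
    (z has_real_derivative v t * x' t) (at t) \<and> (u has_real_derivative u' t) (at t) \<and>
    (v has_real_derivative w t * u' t) (at t) \<and> (w has_real_derivative w' t) (at t) \<and>
    (x' has_real_derivative x'' t) (at t) \<and> (x'' has_real_derivative x''' t) (at t) \<and>
    (u' has_real_derivative u'' t) (at t) \<and> (c < t \<longrightarrow> x' t > 0 \<and> u' t > 0 \<and> w' t > 0)"
  have "\<forall>\<^sub>F t in nhds c. ?regular t"
    using deriv x'' u'' pos[THEN pos_germ_eventually_pos] by eventually_elim simp
  then obtain \<delta> where \<delta>: "\<delta> > 0" "\<And>t. dist t c < \<delta> \<Longrightarrow> ?regular t"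
    unfolding eventually_nhds_metric by blast
  have "smooth_framed_curve c b x y z u v w x' u' w' r origin e1 e2 e3 x'' x''' u''"
    if b: "c < b" "b < c + \<delta>" "{c..b} \<subseteq> I" for b
  proof -
    have regular: "?regular t" if "c \<le> t" "t \<le> b" for t
      using that b by (intro \<delta>(2)) (auto simp: dist_real_def)
    have "continuous_on {c..b} h" if "\<And>t. c \<le> t \<Longrightarrow> t \<le> b \<Longrightarrow> \<exists>l. (h has_real_derivative l) (at t)"
      for h using that DERIV_isCont by (intro continuous_at_imp_continuous_on) fastforce
    then show ?thesis
      by unfold_locales (use regular b det curve in \<open>auto simp del: One_nat_def\<close>)
  qed
  then show ?thesis
    by (intro that[OF \<delta>(1)] smooth_framed_curve.quasi_cubic_if_injective) auto
qed

lemma adapted_flag: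
  fixes a :: "nat \<Rightarrow> real ^ 3"
  assumes spanning: "\<And>n. n \<noteq> 0 \<Longrightarrow> \<exists>l. n \<bullet> a l \<noteq> 0"
  obtains i j k where "i < j" "j < k" "cross3 (a i) (a j) \<bullet> a k \<noteq> 0"
    "\<And>l. l < i \<Longrightarrow> a l = 0" "\<And>l. l < j \<Longrightarrow> cross3 (a i) (a l) = 0"
    "\<And>l. l < k \<Longrightarrow> cross3 (a i) (a j) \<bullet> a l = 0"
proof -
  have "\<exists>l. a l \<noteq> 0"
    using spanning[of "axis 1 1"] by (metis axis_eq_0_iff inner_zero_right zero_neq_one)
  then obtain i where i: "a i \<noteq> 0" "\<And>l. l < i \<Longrightarrow> a l = 0"
    using exists_least_iff[of "\<lambda>l. a l \<noteq> 0"] by auto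
  have "\<exists>l. cross3 (a i) (a l) \<noteq> 0"
  proof -
    obtain m where "cross3 (a i) m \<noteq> 0" using cross_basis_nonzero[OF i(1)] by blast
    then obtain l where "cross3 (a i) m \<bullet> a l \<noteq> 0" using spanning by blast
    then have "cross3 (a l) (a i) \<bullet> m \<noteq> 0" using cross_triple[of "a l" "a i" m] by simp
    then show ?thesis using cross_skew[of "a i" "a l"] by (intro exI[of _ l]) auto
  qed
  then obtain j where j: "cross3 (a i) (a j) \<noteq> 0" "\<And>l. l < j \<Longrightarrow> cross3 (a i) (a l) = 0"
    using exists_least_iff[of "\<lambda>l. cross3 (a i) (a l) \<noteq> 0"] by auto
  obtain k where k: "cross3 (a i) (a j) \<bullet> a k \<noteq> 0" "\<And>l. l < k \<Longrightarrow> cross3 (a i) (a j) \<bullet> a l = 0"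
    using spanning[OF j(1)] exists_least_iff[of "\<lambda>l. cross3 (a i) (a j) \<bullet> a l \<noteq> 0"] by auto
  have "i < j"
  proof (rule ccontr)
    assume "\<not> i < j"
    then have "j = i \<or> a j = 0" using i(2)[of j] by linarith
    then show False using j(1) by auto
  qed
  moreover have "j < k"
  proof (rule ccontr)
    assume "\<not> j < k"
    then have "k = j \<or> cross3 (a i) (a k) = 0" using j(2)[of k] by linarith
    moreover have "cross3 (a i) (a j) \<bullet> a k = - (cross3 (a i) (a k) \<bullet> a j)"
      using cross_triple[of "a i" "a j" "a k"] cross_triple[of "a j" "a k" "a i"]
        cross_triple[of "a k" "a i" "a j"] cross_skew[of "a i" "a k"] by simp
    ultimately show False using k(1) by (auto simp: dot_cross_self)
  qed
  ultimately show ?thesis using that i(2) j(2) k by blast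
qed

definition local_denom :: "real poly ^ 3 \<Rightarrow> real \<Rightarrow> real poly" where
  "local_denom q c = smult (1 / (\<Prod>j\<in>UNIV. poly (q $ j) c)) (\<Prod>j\<in>UNIV. q $ j)"

definition local_num :: "real poly ^ 3 \<Rightarrow> real poly ^ 3 \<Rightarrow> real \<Rightarrow> 3 \<Rightarrow> real poly" where
  "local_num p q c i = pcompose (smult (1 / (\<Prod>j\<in>UNIV. poly (q $ j) c))
     ((p $ i - smult (rat_curve p q c $ i) (q $ i)) * (\<Prod>j\<in>UNIV - {i}. q $ j))) [:c, 1:]"

text \<open>These are the Taylor coefficients at \<open>c\<close> of the increment of the curve times the common
  denominator, scaled to be 1 at \<open>c\<close>. The factor changes neither the osculating flag at \<open>c\<close> nor
  leading coefficients.\<close>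

definition local_coeff :: "real poly ^ 3 \<Rightarrow> real poly ^ 3 \<Rightarrow> real \<Rightarrow> nat \<Rightarrow> real ^ 3" where
  "local_coeff p q c l = (\<chi> i. coeff (local_num p q c i) l)"

lemma poly_local_denom:
  assumes "\<forall>i. poly (q $ i) c \<noteq> 0"
  shows "poly (local_denom q c) c = 1"
  using assms by (simp add: local_denom_def poly_prod)

lemma rat_curve_diff:
  assumes "\<forall>i. poly (q $ i) c \<noteq> 0" "\<forall>i. poly (q $ i) t \<noteq> 0"
  shows "(rat_curve p q t - rat_curve p q c) $ i =
    poly (local_num p q c i) (t - c) / poly (local_denom q c) t"
proof -
  have "(\<Prod>j\<in>UNIV. poly (q $ j) t) = poly (q $ i) t * (\<Prod>j\<in>UNIV - {i}. poly (q $ j) t)"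
    by (rule prod.remove) auto
  then show ?thesis
    using assms
    by (simp add: local_num_def local_denom_def poly_pcompose poly_prod rat_curve_def field_simps)
qed

definition inner_local_num :: "real ^ 3 \<Rightarrow> real poly ^ 3 \<Rightarrow> real poly ^ 3 \<Rightarrow> real \<Rightarrow> real poly" where
  "inner_local_num n p q c = (\<Sum>i\<in>UNIV. smult (n $ i) (local_num p q c i))"

lemma coeff_inner_local_num: "coeff (inner_local_num n p q c) l = n \<bullet> local_coeff p q c l"
  by (simp add: inner_local_num_def coeff_sum local_coeff_def inner_vec_def)

lemma inner_rat_curve_diff:
  assumes "\<forall>i. poly (q $ i) c \<noteq> 0" "\<forall>i. poly (q $ i) t \<noteq> 0"
  shows "n \<bullet> (rat_curve p q t - rat_curve p q c) =
    poly (inner_local_num n p q c) (t - c) / poly (local_denom q c) t"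
  unfolding inner_vec_def rat_curve_diff[OF assms] inner_local_num_def
  by (simp add: poly_sum sum_divide_distrib)

lemma local_coeff_0: "\<forall>i. poly (q $ i) c \<noteq> 0 \<Longrightarrow> local_coeff p q c 0 = 0"
  by (simp add: local_coeff_def local_num_def vec_eq_iff rat_curve_def poly_pcompose
      flip: poly_0_coeff_0)

lemma local_coeff_spanning:
  assumes "\<forall>i. \<forall>t\<in>I. poly (q $ i) t \<noteq> 0" "non_planar (rat_curve p q) I" "c \<in> I" "n \<noteq> 0"
  shows "\<exists>l. n \<bullet> local_coeff p q c l \<noteq> 0"
proof (rule ccontr)
  assume "\<not> ?thesis"
  then have "inner_local_num n p q c = 0"
    by (intro poly_eqI) (simp add: coeff_inner_local_num)
  then have "n \<bullet> (rat_curve p q t - rat_curve p q c) = 0" if "t \<in> I" for t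
    using inner_rat_curve_diff[of q c t n p] assms(1,3) that by simp
  then have "n \<bullet> rat_curve p q t = n \<bullet> rat_curve p q c" if "t \<in> I" for t
    using that by (simp add: inner_diff_right)
  then show False using assms(2,4) unfolding non_planar_def by blast
qed

lemma pos_germ_coordinate:
  assumes "\<forall>i. poly (q $ i) c \<noteq> 0"
    and "\<And>l. l < k \<Longrightarrow> n \<bullet> local_coeff p q c l = 0" "n \<bullet> local_coeff p q c k > 0"
  obtains h where "pos_germ c k h"
    "\<And>t. \<forall>i. poly (q $ i) t \<noteq> 0 \<Longrightarrow> h t = n \<bullet> (rat_curve p q t - rat_curve p q c)"
proof -
  let ?f = "inner_local_num n p q c"
  have "monom 1 k dvd ?f" using assms(2) by (simp add: monom_1_dvd_iff' coeff_inner_local_num)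
  then obtain g where g: "?f = monom 1 k * g" by (rule dvdE)
  have "coeff g 0 = n \<bullet> local_coeff p q c k"
    unfolding coeff_inner_local_num[symmetric] g by (simp add: coeff_monom_mult)
  then have "poly (pcompose g [:- c, 1:]) c / poly (local_denom q c) c > 0"
    using assms(3) by (simp add: poly_pcompose poly_local_denom[OF assms(1)] poly_0_coeff_0)
  then have "pos_germ c k (\<lambda>t. (t - c) ^ k * (poly (pcompose g [:- c, 1:]) t /
      poly (local_denom q c) t))"
    unfolding pos_germ_def by blast
  moreover have "(t - c) ^ k * (poly (pcompose g [:- c, 1:]) t / poly (local_denom q c) t) =
      n \<bullet> (rat_curve p q t - rat_curve p q c)" if "\<forall>i. poly (q $ i) t \<noteq> 0" for t
    using inner_rat_curve_diff[OF assms(1) that, of n p] unfolding g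
    by (simp add: poly_pcompose poly_monom)
  ultimately show ?thesis using that by blast
qed

definition reciprocal :: "real ^ 3 \<Rightarrow> real ^ 3 \<Rightarrow> real ^ 3 \<Rightarrow> real ^ 3" where
  "reciprocal e1 e2 e3 = (1 / (cross3 e1 e2 \<bullet> e3)) *\<^sub>R cross3 e2 e3"

lemma reciprocal_self:
  assumes "cross3 e1 e2 \<bullet> e3 \<noteq> 0"
  shows "reciprocal e1 e2 e3 \<bullet> e1 = 1"
  using assms cross_triple[of e1 e2 e3] by (simp add: reciprocal_def)

lemma reciprocal_expansion:
  assumes "cross3 e1 e2 \<bullet> e3 \<noteq> 0"
  shows "v = (reciprocal e1 e2 e3 \<bullet> v) *\<^sub>R e1 + (reciprocal e2 e3 e1 \<bullet> v) *\<^sub>R e2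
    + (reciprocal e3 e1 e2 \<bullet> v) *\<^sub>R e3"
proof -
  have "cross3 e2 e3 \<bullet> e1 = cross3 e1 e2 \<bullet> e3" "cross3 e3 e1 \<bullet> e2 = cross3 e1 e2 \<bullet> e3"
    using cross_triple[of e1 e2 e3] cross_triple[of e3 e1 e2] by simp_all
  then have "(cross3 e1 e2 \<bullet> e3) *\<^sub>R v = (cross3 e1 e2 \<bullet> e3) *\<^sub>R ((reciprocal e1 e2 e3 \<bullet> v) *\<^sub>R e1
      + (reciprocal e2 e3 e1 \<bullet> v) *\<^sub>R e2 + (reciprocal e3 e1 e2 \<bullet> v) *\<^sub>R e3)"
    using assms by (subst cross3_Cramer) (simp add: reciprocal_def scaleR_add_right)
  then show ?thesis using assms by (simp only: scaleR_cancel_left) simp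
qed

lemma rat_curve_adapted_frame:
  assumes "\<forall>i. \<forall>t\<in>I. poly (q $ i) t \<noteq> 0" "non_planar (rat_curve p q) I" "c \<in> I"
  obtains k1 k2 k3 x y z e1 e2 e3 where
    "0 < k1" "k1 < k2" "k2 < k3" "pos_germ c k1 x" "pos_germ c k2 y" "pos_germ c k3 z"
    "cross3 e1 e2 \<bullet> e3 \<noteq> 0"
    "\<And>t. t \<in> I \<Longrightarrow> rat_curve p q t = rat_curve p q c + x t *\<^sub>R e1 + y t *\<^sub>R e2 + z t *\<^sub>R e3"
proof -
  let ?a = "local_coeff p q c" and ?r = "rat_curve p q"
  have nonzero: "\<forall>i. poly (q $ i) t \<noteq> 0" if "t \<in> I" for t using assms(1) that by blast
  obtain i j k where k: "i < j" "j < k" and det: "cross3 (?a i) (?a j) \<bullet> ?a k \<noteq> 0"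
    and flag: "\<And>l. l < i \<Longrightarrow> ?a l = 0" "\<And>l. l < j \<Longrightarrow> cross3 (?a i) (?a l) = 0"
      "\<And>l. l < k \<Longrightarrow> cross3 (?a i) (?a j) \<bullet> ?a l = 0"
    using adapted_flag[of ?a] local_coeff_spanning[OF assms] by blast
  have "?a i \<noteq> 0" using det by auto
  then have "0 < i" using local_coeff_0[OF nonzero[OF assms(3)], of p] by (cases i) auto
  have rotate: "cross3 (?a j) (?a k) \<bullet> ?a i \<noteq> 0" "cross3 (?a k) (?a i) \<bullet> ?a j \<noteq> 0"
    using det cross_triple[of "?a i" "?a j" "?a k"] cross_triple[of "?a k" "?a i" "?a j"] by simp_all
  note germ = pos_germ_coordinate[OF nonzero[OF assms(3)]]
  obtain x where x: "pos_germ c i x"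
      "\<And>t. t \<in> I \<Longrightarrow> x t = reciprocal (?a i) (?a j) (?a k) \<bullet> (?r t - ?r c)"
    by (rule germ[of i "reciprocal (?a i) (?a j) (?a k)" p])
      (use flag(1) reciprocal_self[OF det] nonzero in auto)
  obtain y where y: "pos_germ c j y"
      "\<And>t. t \<in> I \<Longrightarrow> y t = reciprocal (?a j) (?a k) (?a i) \<bullet> (?r t - ?r c)"
  proof (rule germ[of j "reciprocal (?a j) (?a k) (?a i)" p])
    show "reciprocal (?a j) (?a k) (?a i) \<bullet> ?a l = 0" if "l < j" for l
      using flag(2)[OF that] cross_triple[of "?a k" "?a i" "?a l"] by (simp add: reciprocal_def)
  qed (use reciprocal_self[OF rotate(1)] nonzero that in auto)
  obtain z where z: "pos_germ c k z"
      "\<And>t. t \<in> I \<Longrightarrow> z t = reciprocal (?a k) (?a i) (?a j) \<bullet> (?r t - ?r c)"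
    by (rule germ[of k "reciprocal (?a k) (?a i) (?a j)" p])
      (use flag(3) reciprocal_self[OF rotate(2)] nonzero in \<open>auto simp: reciprocal_def[of "?a k"]\<close>)
  have "?r t = ?r c + x t *\<^sub>R ?a i + y t *\<^sub>R ?a j + z t *\<^sub>R ?a k" if "t \<in> I" for t
  proof -
    have "?r t - ?r c = x t *\<^sub>R ?a i + y t *\<^sub>R ?a j + z t *\<^sub>R ?a k"
      unfolding x(2)[OF that] y(2)[OF that] z(2)[OF that] by (rule reciprocal_expansion[OF det])
    then show ?thesis by (simp add: algebra_simps)
  qed
  then show ?thesis using that[OF \<open>0 < i\<close> k x(1) y(1) z(1) det] by blast
qed

lemma poly_map_poly_complex_of_real:
  "poly (map_poly complex_of_real p) (complex_of_real t) = complex_of_real (poly p t)"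
  by (induction p) (auto simp: map_poly_pCons)

lemma rat_curve_c_of_real:
  "rat_curve_c p q (complex_of_real t) i = complex_of_real (rat_curve p q t $ i)"
  by (simp add: rat_curve_c_def rat_curve_def poly_map_poly_complex_of_real)

lemma proper_param_eventually_injective:
  assumes "proper_param p q" "\<forall>i. \<forall>t\<in>I. poly (q $ i) t \<noteq> 0"
  obtains \<delta> where "\<delta> > 0" "\<And>s t. s \<in> I \<Longrightarrow> t \<in> I \<Longrightarrow> c < t \<Longrightarrow> t < c + \<delta> \<Longrightarrow> s \<noteq> t \<Longrightarrow>
    rat_curve p q s \<noteq> rat_curve p q t"
proof -
  let ?double = "{z. defined_at_c q z \<and>
    (\<exists>w. w \<noteq> z \<and> defined_at_c q w \<and> rat_curve_c p q w = rat_curve_c p q z)}"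
  have "finite (complex_of_real -` ?double)"
    using assms(1) unfolding proper_param_def by (rule finite_vimageI) (simp add: inj_def)
  then obtain \<delta> where \<delta>: "\<delta> > 0"
    "\<And>t. complex_of_real t \<in> ?double \<Longrightarrow> t \<noteq> c \<Longrightarrow> \<delta> \<le> dist c t"
    using finite_set_avoid[of "complex_of_real -` ?double" c] by auto
  have "defined_at_c q (complex_of_real t)" if "t \<in> I" for t
    using that assms(2) by (simp add: defined_at_c_def poly_map_poly_complex_of_real)
  then have double: "complex_of_real t \<in> ?double"
    if "s \<in> I" "t \<in> I" "s \<noteq> t" "rat_curve p q s = rat_curve p q t" for s t
    using that by (auto simp: rat_curve_c_of_real fun_eq_iff intro!: exI[of _ "complex_of_real s"])
  have "rat_curve p q s \<noteq> rat_curve p q t"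
    if "s \<in> I" "t \<in> I" "c < t" "t < c + \<delta>" "s \<noteq> t" for s t
    using double[of s t] \<delta>(2)[of t] that by (auto simp: dist_real_def)
  then show ?thesis using that \<delta>(1) by blast
qed

lemma rat_curve_eventually_quasi_cubic:
  assumes "\<forall>i. \<forall>t\<in>I. poly (q $ i) t \<noteq> 0" "non_planar (rat_curve p q) I" "c \<in> I"
  obtains \<delta> where "\<delta> > 0" "\<And>b. c < b \<Longrightarrow> b < c + \<delta> \<Longrightarrow> {c..b} \<subseteq> I \<Longrightarrow>
    (\<And>s t. c < t \<Longrightarrow> t < b \<Longrightarrow> s \<in> I \<Longrightarrow> s \<noteq> t \<Longrightarrow> rat_curve p q s \<noteq> rat_curve p q t) \<Longrightarrow>
    quasi_cubic (rat_curve p q) I c b"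
proof -
  obtain k1 k2 k3 x y z e1 e2 e3 where orders: "0 < k1" "k1 < k2" "k2 < k3"
    and germs: "pos_germ c k1 x" "pos_germ c k2 y" "pos_germ c k3 z"
    and det: "cross3 e1 e2 \<bullet> e3 \<noteq> 0"
    and curve: "\<And>t. t \<in> I \<Longrightarrow>
      rat_curve p q t = rat_curve p q c + x t *\<^sub>R e1 + y t *\<^sub>R e2 + z t *\<^sub>R e3"
    using rat_curve_adapted_frame[OF assms] by blast
  show ?thesis
    by (rule quasi_cubic_if_pos_germs[where I = I, OF germs orders det curve], assumption)
      (rule that, assumption, blast)
qed

theorem theorem1:
  fixes p q :: "real poly ^ 3" and I :: "real set" and t0 :: real
  assumes "is_interval I"
    and "\<forall>i. \<forall>t\<in>I. poly (q $ i) t \<noteq> 0"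
    and "proper_param p q"
    and "non_planar (rat_curve p q) I"
    and "t0 \<in> I" and "\<exists>t\<in>I. t0 < t"
  shows "\<exists>t1\<in>I. t0 < t1 \<and> quasi_cubic (rat_curve p q) I t0 t1"
proof -
  obtain d where d: "d \<in> I" "t0 < d" using assms(6) by blast
  obtain \<delta> where "\<delta> > 0" and quasi_cubic: "\<And>b. t0 < b \<Longrightarrow> b < t0 + \<delta> \<Longrightarrow> {t0..b} \<subseteq> I \<Longrightarrow>
      (\<And>s t. t0 < t \<Longrightarrow> t < b \<Longrightarrow> s \<in> I \<Longrightarrow> s \<noteq> t \<Longrightarrow> rat_curve p q s \<noteq> rat_curve p q t) \<Longrightarrow>
      quasi_cubic (rat_curve p q) I t0 b"
    using rat_curve_eventually_quasi_cubic[OF assms(2,4,5)] by blast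
  obtain \<epsilon> where "\<epsilon> > 0" and injective: "\<And>s t. s \<in> I \<Longrightarrow> t \<in> I \<Longrightarrow> t0 < t \<Longrightarrow> t < t0 + \<epsilon> \<Longrightarrow>
      s \<noteq> t \<Longrightarrow> rat_curve p q s \<noteq> rat_curve p q t"
    using proper_param_eventually_injective[OF assms(3,2)] by blast
  define t1 where "t1 = min d (t0 + min \<delta> \<epsilon> / 2)"
  have t1: "t0 < t1" "t1 \<le> d" "t1 < t0 + \<delta>" "t1 < t0 + \<epsilon>"
    using d(2) \<open>\<delta> > 0\<close> \<open>\<epsilon> > 0\<close> by (auto simp: t1_def min_def)
  have segment: "{t0..t1} \<subseteq> I"
    using assms(1,5) d(1) t1(2) unfolding is_interval_1 by fastforce
  have "quasi_cubic (rat_curve p q) I t0 t1"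
  proof (rule quasi_cubic[OF t1(1,3) segment])
    show "rat_curve p q s \<noteq> rat_curve p q t" if "t0 < t" "t < t1" "s \<in> I" "s \<noteq> t" for s t
      using injective[of s t] subsetD[OF segment, of t] t1(4) that by simp
  qed
  moreover have "t1 \<in> I" using segment t1(1) by auto
  ultimately show ?thesis using t1(1) by blast
qed

end
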